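(* Let $p>3$ be a prime and let $k\ge 2$ be an integer. If $$\frac{\varphi(p-1)}{W(p-1)\sqrt{p}}>k\,2^{k-1},$$ then $A+B\neq P_p$ for all subsets $A,B\subseteq\mathbb{F}_p$ with $|A|\ge 2$ and $|B|=k$.
   Context: $\mathbb{F}_p$ is the finite field with $p$ elements. $P_p$ denotes the set of primitive elements of $\mathbb{F}_p$, i.e. the generators of the cyclic group $\mathbb{F}_p^{\times}$. For $A,B\subseteq\mathbb{F}_p$, $A+B=\{a+b: a\in A,\ b\in B\}$. $\varphi$ is Euler's totient function, and for a positive integer $n$, $W(n)$ denotes the number of positive square-free divisors of $n$. *)

theory Defs
  imports "HOL-Number_Theory.Number_Theory" "HOL-Computational_Algebra.Squarefree" Complex_Main
begin

text \<open>F_p is modelled as the residues {0..<p}; addition is addition mod p.\<close>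

definition sumset_mod :: "nat \<Rightarrow> nat set \<Rightarrow> nat set \<Rightarrow> nat set" where
  "sumset_mod p A B = {(a + b) mod p | a b. a \<in> A \<and> b \<in> B}"

definition prim_elems :: "nat \<Rightarrow> nat set" where
  "prim_elems p = {g \<in> {0..<p}. residue_primroot p g}"

definition W :: "nat \<Rightarrow> nat" where
  "W n = card {d. 0 < d \<and> d dvd n \<and> squarefree d}"

end

theory Submission
  imports Defs "HOL-Computational_Algebra.Polynomial_Factorial" "HOL-Library.FuncSet"
begin

text \<open>
  Suppose \<open>A + B = P\<close> and pick \<open>b0 \<noteq> b1\<close> in \<open>B\<close>. A primitive \<open>g = a + b\<close> yields the primitive element
  \<open>a + b0 = g + (b0 - b)\<close>, or \<open>a + b1\<close> if \<open>b = b0\<close>. So it suffices to find, for a set \<open>C\<close> of \<open>k\<close> nonzero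
  shifts, a primitive \<open>g\<close> such that no \<open>g + c\<close> with \<open>c \<in> C\<close> is a quadratic nonresidue, i.e. to show that
  the sum of \<open>\<Prod>c\<in>C. 1 + L(g + c)\<close> over the primitive \<open>g\<close> is positive, where \<open>L\<close> is the Legendre symbol.
  Expanding the product over subsets \<open>S\<close> of \<open>C\<close> and sieving the primitive elements by squarefree
  divisors \<open>d\<close> of \<open>p - 1\<close> leaves the sums \<open>(1/d) \<Sum>t. L(\<Prod>c\<in>S. t^d + c)\<close>. Each is at most
  \<open>|S| (\<surd>p + O(1))\<close>, and \<open>\<Sum>S. |S| = k 2^(k-1)\<close>; the \<open>O(1)\<close> terms are absorbed by the much smaller
  sums for \<open>d = 1\<close> and \<open>|S| \<le> 2\<close>.

  The character sum bound comes from Stepanov's method over the prime field, with polynomials over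
  the integers read modulo \<open>p\<close>. For \<open>f\<close> of degree at most \<open>2 m\<close> and \<open>r = (p - 1) / 2\<close>, the auxiliary
  polynomial is \<open>U(z^p, z) \<plusminus> f(z)^r V(z^p, z)\<close>. Since \<open>-r\<close> is \<open>1/2\<close> modulo \<open>p\<close>, it vanishes to order \<open>2 h\<close>
  where \<open>f^r = \<plusminus>1\<close> as soon as \<open>U(x, z) f(z)^(1/2) + V(x, z) f(x)^(1/2)\<close> vanishes to order \<open>2 h\<close> along the
  diagonal \<open>x = z\<close>. Taking the condition of order \<open>i\<close> from the mixed derivative with \<open>i/2\<close> derivatives in
  each variable keeps its denominator down to \<open>f^(i/2)\<close>, and this yields the main term
  \<open>(2 m - 1) \<surd>p\<close> of the right size.
\<close>

section \<open>Congruence modulo a prime in polynomial rings\<close>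

locale prime_modulus =
  fixes p :: nat
  assumes prime_p: "prime p"
begin

text \<open>Reduction modulo p is expressed by divisibility, so one relation serves the integers,
  Z[z] and Z[x, z], and no quotient ring is formed.\<close>

definition cg :: "'a::comm_ring_1 \<Rightarrow> 'a \<Rightarrow> bool" (infix "\<doteq>" 50)
  where "a \<doteq> b \<longleftrightarrow> of_nat p dvd a - b"

lemma cg_refl [simp, intro]: "a \<doteq> a"
  by (simp add: cg_def)

lemma cg_0_iff: "a \<doteq> 0 \<longleftrightarrow> of_nat p dvd a"
  by (simp add: cg_def)

lemma cg_diff_iff: "a - b \<doteq> 0 \<longleftrightarrow> a \<doteq> b"
  by (simp add: cg_def)

lemma cg_sym: "a \<doteq> b \<Longrightarrow> b \<doteq> a"
  unfolding cg_def by (metis dvd_minus_iff minus_diff_eq)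

lemma cg_trans [trans]: "a \<doteq> b \<Longrightarrow> b \<doteq> c \<Longrightarrow> a \<doteq> c"
  unfolding cg_def using dvd_add[of "of_nat p" "a - b" "b - c"] by simp

lemma cg_add: "a \<doteq> b \<Longrightarrow> c \<doteq> d \<Longrightarrow> a + c \<doteq> b + d"
  unfolding cg_def using dvd_add[of "of_nat p" "a - b" "c - d"] by (simp add: algebra_simps)

lemma cg_minus: "a \<doteq> b \<Longrightarrow> - a \<doteq> - b"
  unfolding cg_def using dvd_minus_iff[of "of_nat p" "a - b"] by (simp add: algebra_simps)

lemma cg_diff: "a \<doteq> b \<Longrightarrow> c \<doteq> d \<Longrightarrow> a - c \<doteq> b - d"
  using cg_add[of a b "-c" "-d"] cg_minus[of c d] by simp

lemma cg_mult: assumes "a \<doteq> b" "c \<doteq> d" shows "a * c \<doteq> b * d"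
proof -
  have "a * c - b * d = (a - b) * c + b * (c - d)" by (simp add: algebra_simps)
  then show ?thesis using assms unfolding cg_def by (simp add: dvd_mult dvd_mult2)
qed

lemma cg_power: "a \<doteq> b \<Longrightarrow> a ^ n \<doteq> b ^ n"
  by (induction n) (auto intro: cg_mult)

lemma cg_sum: "(\<And>i. i \<in> A \<Longrightarrow> f i \<doteq> g i) \<Longrightarrow> sum f A \<doteq> sum g A"
  by (induction A rule: infinite_finite_induct) (auto intro: cg_add)

lemma cg_prod: "(\<And>i. i \<in> A \<Longrightarrow> f i \<doteq> g i) \<Longrightarrow> prod f A \<doteq> prod g A"
  by (induction A rule: infinite_finite_induct) (auto intro: cg_mult)

lemma cg_mult_0: "a \<doteq> 0 \<Longrightarrow> a * b \<doteq> 0" "b \<doteq> 0 \<Longrightarrow> a * b \<doteq> 0"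
  by (auto simp: cg_0_iff)

lemma cg_of_nat_p [simp]: "of_nat p \<doteq> 0"
  by (simp add: cg_0_iff)

lemma cg_int_iff: "(a::int) \<doteq> b \<longleftrightarrow> [a = b] (mod int p)"
  by (simp add: cg_def cong_iff_dvd_diff)

lemma of_nat_dvd_poly_iff: "(of_nat p :: 'a::idom poly) dvd f \<longleftrightarrow> (\<forall>i. of_nat p dvd coeff f i)"
  by (subst of_nat_poly) (rule const_poly_dvd_iff)

lemma cg_poly_iff: "(f :: 'a::idom poly) \<doteq> g \<longleftrightarrow> (\<forall>i. coeff f i \<doteq> coeff g i)"
  by (simp add: cg_def of_nat_dvd_poly_iff)

lemma cg_const: "(a::'a::idom) \<doteq> b \<Longrightarrow> [:a:] \<doteq> [:b:]"
  by (simp add: cg_poly_iff coeff_pCons split: nat.splits)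

lemma cg_poly: "f \<doteq> g \<Longrightarrow> poly f x \<doteq> poly g x"
  unfolding cg_def by (metis dvdE dvd_triv_left poly_diff poly_mult poly_of_nat)

lemma cg_pderiv: 
  fixes f g :: "'a :: idom poly"
  assumes "f \<doteq> g" shows "pderiv f \<doteq> pderiv g"
  using assms by (auto simp: cg_poly_iff coeff_pderiv intro!: cg_mult)

lemma cg_pderiv_funpow:
  fixes f g :: "'a :: idom poly"
  assumes "f \<doteq> g" shows "(pderiv ^^ n) f \<doteq> (pderiv ^^ n) g"
  using assms by (induction n) (auto intro: cg_pderiv)

lemma cg_pcompose: "f \<doteq> g \<Longrightarrow> pcompose f q \<doteq> pcompose g q"
  unfolding cg_def
  by (metis dvdE dvd_triv_left of_nat_poly pcompose_const pcompose_diff pcompose_mult)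

section \<open>The reductions modulo p have no zero divisors\<close>

lemma prime_elem_int: "prime_elem (of_nat p :: int)"
  using prime_p by simp

lemma prime_elem_poly: "prime_elem (of_nat p :: int poly)"
  unfolding of_nat_poly by (rule lift_prime_elem_poly[OF prime_elem_int])

lemma prime_elem_poly2: "prime_elem (of_nat p :: int poly poly)"
  by (subst of_nat_poly) (rule lift_prime_elem_poly[OF prime_elem_poly])

lemma cg_mult_0_int: "(a::int) * b \<doteq> 0 \<Longrightarrow> a \<doteq> 0 \<or> b \<doteq> 0"
  unfolding cg_0_iff by (rule prime_elem_dvd_multD[OF prime_elem_int])

lemma cg_mult_0_poly: "(a::int poly) * b \<doteq> 0 \<Longrightarrow> a \<doteq> 0 \<or> b \<doteq> 0"
  unfolding cg_0_iff by (rule prime_elem_dvd_multD[OF prime_elem_poly])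

lemma cg_mult_0_poly2: "(a::int poly poly) * b \<doteq> 0 \<Longrightarrow> a \<doteq> 0 \<or> b \<doteq> 0"
  unfolding cg_0_iff by (rule prime_elem_dvd_multD[OF prime_elem_poly2])

lemma cg_power_0_int: "(a::int) ^ n \<doteq> 0 \<Longrightarrow> a \<doteq> 0"
  unfolding cg_0_iff by (rule prime_elem_dvd_power[OF prime_elem_int])

lemma cg_cancel_poly: "(a::int poly) * b \<doteq> a * c \<Longrightarrow> \<not> a \<doteq> 0 \<Longrightarrow> b \<doteq> c"
  using cg_mult_0_poly[of a "b - c"] cg_diff_iff[of "a * b" "a * c"] cg_diff_iff[of b c]
  by (simp add: algebra_simps)

lemma not_cg_1: "\<not> (1::int) \<doteq> 0"
  using prime_elem_int by (auto simp: cg_0_iff dest: prime_elem_not_unit)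

lemma monic_not_cg_0: "lead_coeff (g::int poly) = 1 \<Longrightarrow> \<not> g \<doteq> 0"
  using not_cg_1 unfolding cg_poly_iff by (metis coeff_0)

section \<open>The Frobenius map\<close>

lemma frobenius_int: "(a::int) ^ p \<doteq> a"
proof (cases "int p dvd a")
  case True
  then have "int p dvd a ^ p" using prime_p by (meson dvd_power dvd_trans prime_gt_0_nat)
  with True show ?thesis by (simp add: cg_def)
next
  case False
  define b where "b = nat (a mod int p)"
  have ab: "int b = a mod int p" using prime_gt_0_nat[OF prime_p] by (simp add: b_def)
  have "[a = int b] (mod int p)" by (simp add: ab)
  moreover have "\<not> p dvd b" using False
    by (metis ab dvd_mod_iff dvd_refl int_dvd_int_iff)
  then have "[b ^ (p - 1) = 1] (mod p)" using fermat_theorem[OF prime_p] by simp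
  then have "[b ^ (p - 1) * b = 1 * b] (mod p)" by (rule cong_mult) simp
  then have "[b ^ p = b] (mod p)" using prime_gt_0_nat[OF prime_p]
    by (metis Suc_pred' mult.commute mult_1 power_Suc)
  then have "[int b ^ p = int b] (mod int p)" by (metis cong_int_iff of_nat_power)
  ultimately show ?thesis unfolding cg_int_iff by (meson cong_pow cong_sym cong_trans)
qed

lemma freshman: "((a::'a::comm_ring_1) + b) ^ p \<doteq> a ^ p + b ^ p"
proof -
  have p0: "p > 0" using prime_gt_0_nat[OF prime_p] .
  have "(a + b) ^ p = (\<Sum>k\<le>p. of_nat (p choose k) * a ^ k * b ^ (p - k))"
    by (rule binomial_ring)
  also have "\<dots> \<doteq> (\<Sum>k\<le>p. if k = 0 then b ^ p else if k = p then a ^ p else 0)"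
  proof (rule cg_sum)
    fix k assume k: "k \<in> {..p}"
    show "of_nat (p choose k) * a ^ k * b ^ (p - k) \<doteq> (if k = 0 then b ^ p else if k = p then a ^ p else 0)"
    proof (cases "k = 0 \<or> k = p")
      case False
      then have "p dvd (p choose k)" using k prime_p by (intro dvd_choose_prime) auto
      then have "(of_nat p :: 'a) dvd of_nat (p choose k)" by (metis dvdE dvd_triv_left of_nat_mult)
      with False show ?thesis by (simp add: cg_0_iff mult.assoc)
    qed (use p0 in auto)
  qed
  also have "(\<Sum>k\<le>p. if k = 0 then b ^ p else if k = p then a ^ p else 0) =
     (\<Sum>k\<in>{0,p}. if k = 0 then b ^ p else if k = p then a ^ p else 0)"
    by (rule sum.mono_neutral_right) auto
  also have "\<dots> = a ^ p + b ^ p" using p0 by simp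
  finally show ?thesis .
qed

text \<open>Splitting off the constant term, the p-th power distributes over a + z f modulo p, and
  Fermat's theorem removes the power from a. Later this turns \<open>f ^ p\<close> into
  f(z^p).\<close>

lemma frobenius_poly: "(f::int poly) ^ p \<doteq> pcompose f (monom 1 p)"
proof (induction f)
  case 0
  then show ?case using prime_gt_0_nat[OF prime_p] by (simp add: power_0_left)
next
  case (pCons a f)
  have "pCons a f = [:a:] + monom 1 1 * f" by (simp add: monom_Suc monom_0)
  then have "(pCons a f) ^ p \<doteq> [:a:] ^ p + (monom 1 1 * f) ^ p" by (simp only: freshman)
  also have "\<dots> = [:a ^ p:] + monom 1 p * f ^ p"
    by (simp add: power_mult_distrib monom_power poly_const_pow)
  also have "\<dots> \<doteq> [:a:] + monom 1 p * pcompose f (monom 1 p)"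
    by (intro cg_add cg_mult pCons.IH cg_const frobenius_int cg_refl)
  finally show ?case by (simp add: pcompose_pCons)
qed

section \<open>Roots with multiplicity modulo p\<close>

lemma linear_factor: 
  assumes "poly f a \<doteq> (0::int)"
  shows "\<exists>h. f \<doteq> [:-a, 1:] * h"
proof -
  have "[:-a,1:] dvd f - [:poly f a:]" by (simp add: poly_eq_0_iff_dvd[symmetric])
  then obtain h where h: "f - [:poly f a:] = [:-a,1:] * h" by blast
  have "f - ([:-a,1:] * h) = [:poly f a:]" using h by (simp add: algebra_simps)
  then have "f - ([:-a,1:] * h) \<doteq> 0" using cg_const[OF assms] by simp
  then show ?thesis using cg_diff_iff by blast
qed

lemma pderiv_funpow_power_linear:
  "poly ((pderiv ^^ n) ([:-a, 1:] ^ n * h)) a = fact n * poly (h::int poly) a"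
proof (induction n arbitrary: h)
  case (Suc n)
  let ?X = "[:-a, 1:] :: int poly"
  have "pderiv (?X ^ Suc n * h) = ?X ^ n * (smult (of_nat (Suc n)) h + ?X * pderiv h)"
    unfolding pderiv_mult pderiv_power_Suc by (simp add: pderiv_pCons algebra_simps)
  then have "(pderiv ^^ Suc n) (?X ^ Suc n * h)
      = (pderiv ^^ n) (?X ^ n * (smult (of_nat (Suc n)) h + ?X * pderiv h))"
    by (simp add: funpow_Suc_right del: funpow.simps power_Suc)
  then show ?case using Suc.IH[of "smult (of_nat (Suc n)) h + ?X * pderiv h"]
    by (simp add: algebra_simps)
qed simp

text \<open>If f is (z - a)^i h modulo p, its i-th derivative at a is i! h(a), so the vanishing of
  that derivative gives another factor z - a. Only i < n <= p occur, so i! is invertible modulo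
  p.\<close>

lemma power_linear_dvd_of_pderiv:
  assumes "\<And>i. i < n \<Longrightarrow> poly ((pderiv ^^ i) f) a \<doteq> (0::int)" "n \<le> p"
  shows "\<exists>h. f \<doteq> [:-a, 1:] ^ n * h"
  using assms
proof (induction n)
  case (Suc n)
  then obtain h where h: "f \<doteq> [:-a, 1:] ^ n * h" by auto
  have "fact n * poly h a \<doteq> 0"
    using cg_trans[OF cg_sym[OF cg_poly[OF cg_pderiv_funpow[OF h, of n], of a]] Suc.prems(1)[of n]]
    by (simp only: pderiv_funpow_power_linear lessI)
  moreover have "\<not> (fact n :: int) \<doteq> 0"
  proof -
    have "\<not> p dvd fact n" using Suc.prems(2) prime_p by (simp add: prime_dvd_fact_iff)
    then show ?thesis unfolding cg_0_iff by (metis int_dvd_int_iff of_nat_fact)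
  qed
  ultimately have "poly h a \<doteq> 0" using cg_mult_0_int by blast
  then obtain k where "h \<doteq> [:-a,1:] * k" using linear_factor by blast
  then have "[:-a, 1:] ^ n * h \<doteq> [:-a, 1:] ^ n * ([:-a,1:] * k)" by (intro cg_mult cg_refl)
  with h have "f \<doteq> [:-a, 1:] ^ n * ([:-a,1:] * k)" by (rule cg_trans)
  then show ?case by (intro exI[of _ k]) (simp only: power_Suc mult_ac)
qed (auto intro!: exI[of _ f])

lemma power_linear_not_0: "\<not> [:-a, 1:] ^ n \<doteq> (0::int poly)"
  by (rule monic_not_cg_0) (simp add: lead_coeff_power)

lemma power_linear_dvd_cofactor:
  assumes "f * g \<doteq> [:-a, 1:] ^ n * h" "\<not> poly g a \<doteq> (0::int)"
  shows "\<exists>h. f \<doteq> [:-a, 1:] ^ n * h"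
  using assms
proof (induction n arbitrary: h)
  case (Suc n)
  have eq: "f * g \<doteq> [:-a, 1:] ^ n * ([:-a,1:] * h)" using Suc.prems(1) by (simp only: power_Suc mult_ac)
  then obtain k where k: "f \<doteq> [:-a, 1:] ^ n * k" using Suc.IH Suc.prems(2) by blast
  have "[:-a, 1:] ^ n * (k * g) \<doteq> f * g"
    using cg_mult[OF cg_sym[OF k] cg_refl[of g]] by (simp add: mult_ac)
  also note eq
  finally have "k * g \<doteq> [:-a,1:] * h" using power_linear_not_0 by (rule cg_cancel_poly)
  from cg_poly[OF this, of a] have "poly k a * poly g a \<doteq> 0" by simp
  with Suc.prems(2) have "poly k a \<doteq> 0" using cg_mult_0_int by blast
  then obtain l where "k \<doteq> [:-a,1:] * l" using linear_factor by blast
  then have "[:-a, 1:] ^ n * k \<doteq> [:-a, 1:] ^ n * ([:-a,1:] * l)" by (intro cg_mult cg_refl)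
  with k have "f \<doteq> [:-a, 1:] ^ n * ([:-a,1:] * l)" by (rule cg_trans)
  then show ?case by (intro exI[of _ l]) (simp only: power_Suc mult_ac)
qed (auto intro!: exI[of _ f])

text \<open>The degree of h over the integers may exceed its degree modulo p, so degrees cannot be
  compared directly. As g is monic, the leading coefficient of h is a coefficient of g h beyond the
  degree of f, hence 0 modulo p; it is stripped and the argument repeats.\<close>

lemma monic_dvd_cg_0:
  assumes "f \<doteq> g * h" "lead_coeff (g::int poly) = 1" "degree f < degree g"
  shows "f \<doteq> 0"
proof -
  have "h \<doteq> 0" using assms(1)
  proof (induction "degree h" arbitrary: h rule: less_induct)
    case less
    have "lead_coeff (g * h) = lead_coeff h" using assms(2) by (simp add: lead_coeff_mult)
    moreover have "h \<noteq> 0 \<Longrightarrow> degree (g * h) = degree g + degree h"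
      using assms(2) by (intro degree_mult_eq) auto
    ultimately have "h \<noteq> 0 \<Longrightarrow> coeff (g * h) (degree g + degree h) = lead_coeff h" by simp
    moreover have "coeff f (degree g + degree h) = 0" using assms(3) by (simp add: coeff_eq_0)
    ultimately have lc: "lead_coeff h \<doteq> 0"
      using less.prems unfolding cg_poly_iff by (metis cg_refl cg_sym leading_coeff_0_iff)
    define h' where "h' = h - monom (lead_coeff h) (degree h)"
    have hh': "h \<doteq> h'" using lc
      by (simp add: h'_def cg_poly_iff coeff_diff coeff_monom cg_def)
    show ?case
    proof (cases "degree h = 0")
      case True
      then have "h = [:lead_coeff h:]" by (metis degree_eq_zeroE degree_pCons_0 coeff_pCons_0)
      then show ?thesis using cg_const[OF lc] by simp
    next
      case False
      have "degree h' < degree h"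
      proof (rule degree_lessI)
        show "h' \<noteq> 0 \<or> 0 < degree h" using False by simp
        show "\<forall>k\<ge>degree h. coeff h' k = 0"
          by (auto simp: h'_def coeff_eq_0)
      qed
      moreover have "f \<doteq> g * h'" using cg_trans[OF less.prems cg_mult[OF cg_refl hh']] .
      ultimately have "h' \<doteq> 0" by (rule less.hyps)
      with hh' show ?thesis by (rule cg_trans)
    qed
  qed
  then have "g * h \<doteq> 0" by (rule cg_mult_0)
  with assms(1) show ?thesis by (rule cg_trans)
qed

text \<open>The linear factors of distinct residues are coprime modulo p, so their n-th powers
  divide f jointly. Their product is monic of degree n |T|, which no f of smaller degree survives
  unless it is 0 modulo p.\<close>

lemma count_roots:
  assumes "finite T" "T \<subseteq> {0..<int p}" "\<And>a. a \<in> T \<Longrightarrow> \<exists>h. f \<doteq> [:-a, 1:] ^ n * h" "\<not> f \<doteq> 0"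
  shows "n * card T \<le> degree f"
proof (rule ccontr)
  assume neg: "\<not> n * card T \<le> degree f"
  have "\<exists>h. f \<doteq> (\<Prod>a\<in>T. [:-a, 1:] ^ n) * h" using assms(1-3)
  proof (induction T rule: finite_induct)
    case empty then show ?case by (auto intro!: exI[of _ f])
  next
    case (insert b T)
    then obtain h where h: "f \<doteq> (\<Prod>a\<in>T. [:-a, 1:] ^ n) * h" by auto
    from insert.prems obtain k where k: "f \<doteq> [:-b, 1:] ^ n * k" by auto
    have "h * (\<Prod>a\<in>T. [:-a, 1:] ^ n) \<doteq> [:-b, 1:] ^ n * k"
      using cg_trans[OF cg_sym[OF h] k] by (simp add: mult_ac)
    moreover have "\<not> poly (\<Prod>a\<in>T. [:-a, 1:] ^ n) b \<doteq> 0"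
    proof
      assume "poly (\<Prod>a\<in>T. [:-a, 1:] ^ n) b \<doteq> 0"
      then have "int p dvd (\<Prod>a\<in>T. (b - a) ^ n)" by (simp add: poly_prod cg_0_iff)
      then obtain a where a: "a \<in> T" "int p dvd (b - a) ^ n"
        using prime_p prime_dvd_prod_iff[OF insert.hyps(1), of "int p"] by auto
      then have "int p dvd b - a" using prime_p by (metis prime_dvd_power prime_nat_int_transfer)
      moreover have "\<bar>b - a\<bar> < int p" using insert.prems(1) a(1) by (force simp: abs_if)
      moreover have "b - a \<noteq> 0" using insert.hyps(2) a(1) by auto
      ultimately show False using zdvd_imp_le[of "int p" "\<bar>b - a\<bar>"] by simp
    qed
    ultimately obtain l where "h \<doteq> [:-b, 1:] ^ n * l" using power_linear_dvd_cofactor by blast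
    then have "(\<Prod>a\<in>T. [:-a, 1:] ^ n) * h \<doteq> (\<Prod>a\<in>T. [:-a, 1:] ^ n) * ([:-b, 1:] ^ n * l)"
      by (intro cg_mult cg_refl)
    with h have "f \<doteq> (\<Prod>a\<in>T. [:-a, 1:] ^ n) * ([:-b, 1:] ^ n * l)" by (rule cg_trans)
    then show ?case using insert.hyps by (auto simp: mult_ac intro!: exI[of _ l])
  qed
  then obtain h where h: "f \<doteq> (\<Prod>a\<in>T. [:-a, 1:] ^ n) * h" by blast
  have "lead_coeff (\<Prod>a\<in>T. [:-a, 1:] ^ n) = 1"
    by (simp add: lead_coeff_prod lead_coeff_power)
  moreover have "degree (\<Prod>a\<in>T. [:-a, 1:] ^ n) = n * card T"
    by (subst degree_prod_eq_sum_degree) (auto simp: degree_power_eq)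
  ultimately have "f \<doteq> 0" using monic_dvd_cg_0[OF h] neg by simp
  with assms(4) show False by simp
qed

end

section \<open>Derivatives of bivariate polynomials along the diagonal\<close>

text \<open>An element of \<open>int poly poly\<close> is read as P(x, z), with x the outer variable
  and z the variable of the coefficients. So \<open>lift_poly f\<close> is f(x),
  \<open>[:f:]\<close> is f(z), and \<open>pderiv\<close> and \<open>pderiv_inner\<close> are the
  partial derivatives in x and in z.\<close>

abbreviation lift_poly :: "int poly \<Rightarrow> int poly poly" where
  "lift_poly f \<equiv> map_poly (\<lambda>c. [:c:]) f"

definition pderiv_inner :: "int poly poly \<Rightarrow> int poly poly" where
  "pderiv_inner = map_poly pderiv"

lemma coeff_pderiv_inner: "coeff (pderiv_inner P) i = pderiv (coeff P i)"
  by (simp add: pderiv_inner_def coeff_map_poly)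

lemma pderiv_inner_pCons: "pderiv_inner (pCons a P) = pCons (pderiv a) (pderiv_inner P)"
  by (intro poly_eqI) (simp add: coeff_pderiv_inner coeff_pCons split: nat.splits)

lemma pderiv_inner_0 [simp]: "pderiv_inner 0 = 0"
  by (simp add: pderiv_inner_def)

lemma pderiv_inner_add: "pderiv_inner (P + Q) = pderiv_inner P + pderiv_inner Q"
  by (intro poly_eqI) (simp add: coeff_pderiv_inner pderiv_add)

lemma pderiv_inner_diff: "pderiv_inner (P - Q) = pderiv_inner P - pderiv_inner Q"
  by (intro poly_eqI) (simp add: coeff_pderiv_inner pderiv_diff)

lemma pderiv_inner_mult: "pderiv_inner (P * Q) = P * pderiv_inner Q + Q * pderiv_inner P"
proof (rule poly_eqI)
  fix n
  have "coeff (pderiv_inner (P * Q)) n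
      = (\<Sum>i\<le>n. coeff P i * pderiv (coeff Q (n - i)) + pderiv (coeff P i) * coeff Q (n - i))"
    by (simp add: coeff_pderiv_inner coeff_mult higher_pderiv_sum[of 1, simplified] pderiv_mult mult.commute)
  also have "\<dots> = coeff (P * pderiv_inner Q + pderiv_inner P * Q) n"
    by (simp add: coeff_pderiv_inner coeff_mult sum.distrib)
  finally show "coeff (pderiv_inner (P * Q)) n = coeff (P * pderiv_inner Q + Q * pderiv_inner P) n"
    by (simp add: mult.commute)
qed

lemma pderiv_inner_const: "pderiv_inner [:f:] = [:pderiv f:]"
  by (simp add: pderiv_inner_pCons)

lemma pderiv_inner_lift: "pderiv_inner (lift_poly f) = 0"
  by (intro poly_eqI) (simp add: coeff_pderiv_inner coeff_map_poly)

lemma pderiv_lift: "pderiv (lift_poly f) = lift_poly (pderiv f)"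
  by (intro poly_eqI) (simp add: coeff_map_poly coeff_pderiv of_nat_poly mult.commute)

lemma pderiv_inner_commute: "pderiv_inner (pderiv P) = pderiv (pderiv_inner P)"
  by (intro poly_eqI) (simp add: coeff_pderiv_inner coeff_pderiv pderiv_mult pderiv_add)

lemma pderiv_inner_funpow_commute: 
  "(pderiv_inner ^^ a) (pderiv P) = pderiv ((pderiv_inner ^^ a) P)"
  by (induction a) (simp_all add: pderiv_inner_commute)

text \<open>Used twice: with q = z for derivatives along the diagonal, and with q = z^p, where the
  second term vanishes modulo p.\<close>

lemma pderiv_poly_chain:
  "pderiv (poly P q) = poly (pderiv_inner P) q + poly (pderiv P) q * pderiv q"
proof (induction P)
  case (pCons a P)
  then show ?case
    by (simp add: pderiv_add pderiv_mult pderiv_inner_pCons pderiv_pCons algebra_simps)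
qed simp

lemma poly_lift_poly: "poly (lift_poly f) q = pcompose f q"
  by (simp add: pcompose_altdef)

definition diag :: "int poly poly \<Rightarrow> int poly" where
  "diag P = poly P [:0, 1:]"

definition diag_deriv :: "nat \<Rightarrow> nat \<Rightarrow> int poly poly \<Rightarrow> int poly" where
  "diag_deriv a b P = diag ((pderiv_inner ^^ a) ((pderiv ^^ b) P))"

lemma pderiv_diag_deriv:
  "pderiv (diag_deriv a b P) = diag_deriv (Suc a) b P + diag_deriv a (Suc b) P"
  by (simp add: diag_deriv_def diag_def pderiv_poly_chain pderiv_inner_funpow_commute pderiv_pCons)

text \<open>Differentiating a vanishing diagonal derivative of order m shows that neighbouring mixed
  derivatives of order m + 1 agree up to sign modulo p. So one mixed derivative in each order
  controls all of them, and \<open>b i\<close> may be picked to keep degrees low.\<close>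

lemma (in prime_modulus) diag_deriv_all_cg_0:
  assumes "\<And>i. i < n \<Longrightarrow> b i \<le> i \<and> diag_deriv (i - b i) (b i) P \<doteq> 0"
  shows "a + c < n \<Longrightarrow> diag_deriv a c P \<doteq> 0"
proof (induction "a + c" arbitrary: a c)
  case 0
  then have "a = 0" "c = 0" "b 0 = 0" using assms[of 0] by auto
  then show ?case using assms[of 0] 0 by simp
next
  case (Suc m)
  have step: "diag_deriv (m - j) (Suc j) P \<doteq> 0 \<longleftrightarrow> diag_deriv (Suc m - j) j P \<doteq> 0" if "j \<le> m" for j
  proof -
    have "diag_deriv (m - j) j P \<doteq> 0" using Suc that by auto
    then have "pderiv (diag_deriv (m - j) j P) \<doteq> 0" using cg_pderiv by fastforce
    then have *: "diag_deriv (Suc m - j) j P + diag_deriv (m - j) (Suc j) P \<doteq> 0"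
      using that by (simp add: pderiv_diag_deriv Suc_diff_le)
    show ?thesis using * unfolding cg_0_iff by (metis dvd_add_right_iff dvd_add_left_iff)
  qed
  have iff: "diag_deriv (Suc m - j) j P \<doteq> 0 \<longleftrightarrow> diag_deriv (Suc m) 0 P \<doteq> 0" if "j \<le> Suc m" for j
    using that
  proof (induction j)
    case (Suc j)
    then show ?case using step[of j] by simp
  qed simp
  have ac: "Suc m < n" "a = Suc m - c" "c \<le> Suc m" using Suc.hyps(2) Suc.prems by auto
  show ?case using assms[OF ac(1)] iff[of "b (Suc m)"] iff[OF ac(3)] ac(2) by simp
qed

section \<open>Derivatives with powers of f factored out\<close>

definition twist_inner :: "nat \<Rightarrow> int poly \<Rightarrow> nat \<Rightarrow> int poly poly \<Rightarrow> int poly poly" where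
  "twist_inner e f j U = [:f:] * pderiv_inner U + of_nat (e - j) * [:pderiv f:] * U"

definition twist_outer :: "nat \<Rightarrow> int poly \<Rightarrow> nat \<Rightarrow> int poly poly \<Rightarrow> int poly poly" where
  "twist_outer e f j V = lift_poly f * pderiv V + of_nat (e - j) * lift_poly (pderiv f) * V"

text \<open>The operator depends on the step because the exponent of f drops with each derivative.
  The iterates are the cofactors of f^(e - j) in the j-th derivative of f^e U; written this way, the
  degree grows by at most deg f - 1 per step.\<close>

fun twists :: "(nat \<Rightarrow> 'a \<Rightarrow> 'a) \<Rightarrow> nat \<Rightarrow> 'a \<Rightarrow> 'a" where
  "twists t 0 U = U"
| "twists t (Suc j) U = t j (twists t j U)"

lemma pderiv_inner_power_Suc:
  "pderiv_inner (F ^ Suc n) = of_nat (Suc n) * F ^ n * pderiv_inner F"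
proof (induction n)
  case (Suc n)
  have "pderiv_inner (F ^ Suc (Suc n)) = F * pderiv_inner (F ^ Suc n) + F ^ Suc n * pderiv_inner F"
    by (simp only: power_Suc[of F "Suc n"] pderiv_inner_mult)
  then show ?case unfolding Suc by (simp add: algebra_simps)
qed simp

lemma pderiv_inner_power_mult:
  assumes "j < e"
  shows "pderiv_inner ([:f:] ^ (e - j) * U) = [:f:] ^ (e - Suc j) * twist_inner e f j U"
proof -
  obtain n where n: "e - j = Suc n" "e - Suc j = n" using assms by (metis Suc_diff_Suc)
  show ?thesis unfolding n twist_inner_def pderiv_inner_mult pderiv_inner_power_Suc pderiv_inner_const
    by (simp add: algebra_simps smult_add_right)
qed

lemma pderiv_outer_power_mult:
  assumes "j < e"
  shows "pderiv (lift_poly f ^ (e - j) * U) = lift_poly f ^ (e - Suc j) * twist_outer e f j U"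
proof -
  obtain n where n: "e - j = Suc n" "e - Suc j = n" using assms by (metis Suc_diff_Suc)
  have *: "pderiv (lift_poly f ^ Suc n) = of_nat (Suc n) * lift_poly f ^ n * lift_poly (pderiv f)"
    by (simp only: pderiv_power_Suc pderiv_lift) (simp add: of_nat_poly)
  show ?thesis unfolding n twist_outer_def pderiv_mult * by (simp add: algebra_simps)
qed

lemma pderiv_inner_funpow_twists:
  "j \<le> e \<Longrightarrow> (pderiv_inner ^^ j) ([:f:] ^ e * U) = [:f:] ^ (e - j) * twists (twist_inner e f) j U"
  by (induction j) (simp_all add: pderiv_inner_power_mult)

lemma pderiv_outer_funpow_twists:
  "j \<le> e \<Longrightarrow> (pderiv ^^ j) (lift_poly f ^ e * U) = lift_poly f ^ (e - j) * twists (twist_outer e f) j U"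
  by (induction j) (simp_all add: pderiv_outer_power_mult)

lemma twist_inner_diff: "twist_inner e f j (U - V) = twist_inner e f j U - twist_inner e f j V"
  by (simp add: twist_inner_def pderiv_inner_diff algebra_simps smult_diff_right)

lemma twist_outer_diff: "twist_outer e f j (U - V) = twist_outer e f j U - twist_outer e f j V"
  by (simp add: twist_outer_def pderiv_diff algebra_simps)

lemma twists_inner_diff:
  "twists (twist_inner e f) j (U - V) = twists (twist_inner e f) j U - twists (twist_inner e f) j V"
  by (induction j) (simp_all add: twist_inner_diff)

lemma twists_outer_diff:
  "twists (twist_outer e f) j (U - V) = twists (twist_outer e f) j U - twists (twist_outer e f) j V"
  by (induction j) (simp_all add: twist_outer_diff)

section \<open>Total degree in x and z\<close>

definition total_degree_less :: "int poly poly \<Rightarrow> nat \<Rightarrow> bool" where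
  "total_degree_less P n \<longleftrightarrow> (\<forall>i. coeff P i \<noteq> 0 \<longrightarrow> degree (coeff P i) + i < n)"

text \<open>The strict bound makes the zero polynomial the case n = 0, so truncated subtraction in n
  matches differentiation.\<close>

lemma total_degree_less_0: "total_degree_less P 0 \<longleftrightarrow> P = 0"
  by (auto simp: total_degree_less_def poly_eq_iff)

lemma total_degree_less_zero [simp]: "total_degree_less 0 n"
  by (simp add: total_degree_less_def)

lemma total_degree_less_add:
  assumes "total_degree_less P n" "total_degree_less Q n"
  shows "total_degree_less (P + Q) n"
  unfolding total_degree_less_def
proof (intro allI impI)
  fix i assume nz: "coeff (P + Q) i \<noteq> 0"
  have "degree (coeff P i + coeff Q i) + i < n"
  proof (cases "coeff P i = 0 \<or> coeff Q i = 0")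
    case True
    then show ?thesis using nz assms unfolding total_degree_less_def by auto
  next
    case False
    then show ?thesis using degree_add_le_max[of "coeff P i" "coeff Q i"] assms
      unfolding total_degree_less_def by fastforce
  qed
  then show "degree (coeff (P + Q) i) + i < n" by simp
qed

lemma total_degree_less_mult:
  assumes "total_degree_less P (Suc m)" "total_degree_less Q n"
  shows "total_degree_less (P * Q) (m + n)"
  unfolding total_degree_less_def
proof (intro allI impI)
  fix k assume nz: "coeff (P * Q) k \<noteq> 0"
  have lt: "degree (coeff P i * coeff Q (k - i)) + k < m + n" if "i \<le> k" "coeff P i * coeff Q (k - i) \<noteq> 0" for i
  proof -
    have "degree (coeff P i) + i < Suc m" "degree (coeff Q (k - i)) + (k - i) < n"
      using that assms unfolding total_degree_less_def by auto
    moreover have "degree (coeff P i * coeff Q (k - i)) \<le> degree (coeff P i) + degree (coeff Q (k - i))"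
      by (rule degree_mult_le)
    ultimately show ?thesis using that(1) by linarith
  qed
  from nz obtain i where i: "i \<le> k" "coeff P i * coeff Q (k - i) \<noteq> 0"
    unfolding coeff_mult by (metis (no_types, lifting) atMost_iff sum.neutral)
  have kb: "k < m + n" using lt[OF i] by simp
  have "degree (coeff (P * Q) k) \<le> m + n - Suc k"
    unfolding coeff_mult
  proof (rule degree_sum_le)
    fix i assume "i \<in> {..k}"
    then show "degree (coeff P i * coeff Q (k - i)) \<le> m + n - Suc k"
      using lt[of i] by (cases "coeff P i * coeff Q (k - i) = 0") auto
  qed simp
  with kb show "degree (coeff (P * Q) k) + k < m + n" by simp
qed

lemma total_degree_less_const: "degree f \<le> m \<Longrightarrow> total_degree_less [:f:] (Suc m)"
  by (auto simp: total_degree_less_def coeff_pCons split: nat.splits)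

lemma total_degree_less_lift: "degree f \<le> m \<Longrightarrow> total_degree_less (lift_poly f) (Suc m)"
  using le_degree[of f] by (fastforce simp: total_degree_less_def coeff_map_poly)

lemma total_degree_less_of_nat: "total_degree_less (of_nat k) (Suc 0)"
  by (auto simp: total_degree_less_def of_nat_poly coeff_pCons split: nat.splits)

lemma total_degree_less_pderiv: "total_degree_less P n \<Longrightarrow> total_degree_less (pderiv P) (n - 1)"
  unfolding total_degree_less_def
proof (intro allI impI)
  fix i assume P: "\<forall>i. coeff P i \<noteq> 0 \<longrightarrow> degree (coeff P i) + i < n" and nz: "coeff (pderiv P) i \<noteq> 0"
  then have "coeff P (Suc i) \<noteq> 0" by (auto simp: coeff_pderiv)
  with P have "degree (coeff P (Suc i)) + Suc i < n" by blast
  moreover have "degree (coeff (pderiv P) i) \<le> degree (coeff P (Suc i))"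
    unfolding coeff_pderiv of_nat_poly by simp
  ultimately show "degree (coeff (pderiv P) i) + i < n - 1" by simp
qed

lemma total_degree_less_pderiv_inner: 
  "total_degree_less P n \<Longrightarrow> total_degree_less (pderiv_inner P) (n - 1)"
  unfolding total_degree_less_def
proof (intro allI impI)
  fix i assume P: "\<forall>i. coeff P i \<noteq> 0 \<longrightarrow> degree (coeff P i) + i < n" and nz: "coeff (pderiv_inner P) i \<noteq> 0"
  then have "degree (coeff P i) \<noteq> 0" by (auto simp: coeff_pderiv_inner pderiv_eq_0_iff)
  moreover from this have "coeff P i \<noteq> 0" by auto
  then have "degree (coeff P i) + i < n" using P by blast
  ultimately show "degree (coeff (pderiv_inner P) i) + i < n - 1"
    by (simp add: coeff_pderiv_inner degree_pderiv)
qed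

lemma total_degree_less_pderiv_funpow: 
  "total_degree_less P n \<Longrightarrow> total_degree_less ((pderiv ^^ j) P) (n - j)"
  by (induction j) (auto dest: total_degree_less_pderiv)

lemma total_degree_less_pderiv_inner_funpow: 
  "total_degree_less P n \<Longrightarrow> total_degree_less ((pderiv_inner ^^ j) P) (n - j)"
  by (induction j) (auto dest: total_degree_less_pderiv_inner)

text \<open>In each summand one derivative falls on U or on f, so a twist raises the degree by at
  most deg f - 1; this is why the bound on deg f is written \<open>Suc m\<close>.\<close>

lemma total_degree_less_twist_inner:
  assumes "degree f \<le> Suc m" "total_degree_less U n"
  shows "total_degree_less (twist_inner e f j U) (n + m)"
proof (cases n)
  case 0
  then show ?thesis using assms by (simp add: total_degree_less_0 twist_inner_def)
next
  case (Suc k)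
  have "total_degree_less ([:f:] * pderiv_inner U) (Suc m + k)"
    using total_degree_less_pderiv_inner[OF assms(2)] Suc
    by (intro total_degree_less_mult total_degree_less_const assms(1)) simp
  moreover have "total_degree_less (of_nat (e - j) * ([:pderiv f:] * U)) (0 + (m + n))"
    using assms by (intro total_degree_less_mult total_degree_less_of_nat total_degree_less_const)
      (auto simp: degree_pderiv)
  ultimately show ?thesis unfolding twist_inner_def using Suc
    by (intro total_degree_less_add) (simp_all add: add_ac mult.assoc)
qed

lemma total_degree_less_twist_outer:
  assumes "degree f \<le> Suc m" "total_degree_less U n"
  shows "total_degree_less (twist_outer e f j U) (n + m)"
proof (cases n)
  case 0
  then show ?thesis using assms by (simp add: total_degree_less_0 twist_outer_def)
next
  case (Suc k)
  have "total_degree_less (lift_poly f * pderiv U) (Suc m + k)"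
    using total_degree_less_pderiv[OF assms(2)] Suc
    by (intro total_degree_less_mult total_degree_less_lift assms(1)) simp
  moreover have "total_degree_less (of_nat (e - j) * (lift_poly (pderiv f) * U)) (0 + (m + n))"
    using assms by (intro total_degree_less_mult total_degree_less_of_nat total_degree_less_lift)
      (auto simp: degree_pderiv)
  ultimately show ?thesis unfolding twist_outer_def using Suc
    by (intro total_degree_less_add) (simp_all add: add_ac mult.assoc)
qed

lemma total_degree_less_twists_inner:
  assumes "degree f \<le> Suc m" "total_degree_less U n"
  shows "total_degree_less (twists (twist_inner e f) j U) (n + j * m)"
proof (induction j)
  case (Suc j)
  then show ?case using total_degree_less_twist_inner[OF assms(1) Suc, of e j]
    by (simp add: add_ac)
qed (use assms in simp)

lemma total_degree_less_twists_outer: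
  assumes "degree f \<le> Suc m" "total_degree_less U n"
  shows "total_degree_less (twists (twist_outer e f) j U) (n + j * m)"
proof (induction j)
  case (Suc j)
  then show ?case using total_degree_less_twist_outer[OF assms(1) Suc, of e j]
    by (simp add: add_ac)
qed (use assms in simp)

lemma coeff_diag_eq_0:
  assumes "total_degree_less P n" "n \<le> k"
  shows "coeff (diag P) k = 0"
proof -
  have x: "[:0, 1:] ^ i = monom 1 i" for i :: nat
    by (metis monom_altdef smult_1_left)
  have "coeff (diag P) k = (\<Sum>i\<le>degree P. coeff (coeff P i * monom 1 i) k)"
    by (simp add: diag_def poly_altdef x coeff_sum)
  also have "\<dots> = 0"
  proof (intro sum.neutral ballI)
    fix i
    show "coeff (coeff P i * monom 1 i) k = 0"
    proof (cases "coeff P i = 0")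
      case False
      then have "degree (coeff P i) + i < n" using assms(1) by (simp add: total_degree_less_def)
      then have "degree (coeff P i * monom 1 i) < k"
        using assms(2) degree_mult_le[of "coeff P i" "monom 1 i"] degree_monom_le[of "1::int" i] by linarith
      then show ?thesis by (rule coeff_eq_0)
    qed simp
  qed
  finally show ?thesis .
qed

section \<open>Auxiliary polynomials\<close>

context prime_modulus
begin

text \<open>Stands in for linear algebra over F_p: with more unknowns than equations, two vectors
  with entries in {0..<p} have the same residues under \<open>\<phi>\<close>. An entry where they
  differ gives a difference of absolute value below p, hence not 0 modulo p.\<close>

lemma pigeonhole_kernel:
  fixes \<phi> :: "('i \<Rightarrow> int) \<Rightarrow> 'j \<Rightarrow> int"
  assumes fin: "finite I" "finite J" and card: "card J < card I"
    and diff: "\<And>v w j. \<phi> (\<lambda>i. v i - w i) j = \<phi> v j - \<phi> w j"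
  obtains w where "\<exists>i\<in>I. \<not> w i \<doteq> 0" "\<forall>j\<in>J. \<phi> w j \<doteq> 0"
proof -
  define X where "X = (\<Pi>\<^sub>E i\<in>I. {0..<int p})"
  define g where "g w = restrict (\<lambda>j. \<phi> w j mod int p) J" for w
  have p1: "p > 1" using prime_gt_1_nat[OF prime_p] .
  have "g ` X \<subseteq> (\<Pi>\<^sub>E j\<in>J. {0..<int p})" using p1 by (auto simp: g_def)
  moreover have "finite (\<Pi>\<^sub>E j\<in>J. {0..<int p})" using fin by (intro finite_PiE) auto
  ultimately have "card (g ` X) \<le> card (\<Pi>\<^sub>E j\<in>J. {0..<int p})" by (rule card_mono[rotated])
  also have "\<dots> = p ^ card J" using fin by (simp add: card_PiE)
  also have "\<dots> < p ^ card I" using card p1 by simp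
  also have "\<dots> = card X" using fin by (simp add: X_def card_PiE)
  finally have "\<not> inj_on g X" by (metis card_image less_irrefl)
  then obtain v w where vw: "v \<in> X" "w \<in> X" "v \<noteq> w" "g v = g w" by (auto simp: inj_on_def)
  define u where "u i = v i - w i" for i
  have "\<exists>i\<in>I. v i \<noteq> w i" using vw(1-3) unfolding X_def by (metis PiE_ext)
  then obtain i where i: "i \<in> I" "v i \<noteq> w i" by blast
  have "0 \<le> v i" "v i < int p" "0 \<le> w i" "w i < int p" using vw i by (auto simp: X_def dest!: PiE_mem)
  then have "\<not> int p dvd u i" using i(2) zdvd_imp_le[of "int p" "\<bar>u i\<bar>"] by (auto simp: u_def)
  then have 1: "\<exists>i\<in>I. \<not> u i \<doteq> 0" using i(1) by (auto simp: cg_0_iff)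
  have 2: "\<phi> u j \<doteq> 0" if "j \<in> J" for j
  proof -
    have "\<phi> v j mod int p = \<phi> w j mod int p" using fun_cong[OF vw(4), of j] that by (simp add: g_def)
    then show ?thesis unfolding u_def[abs_def] diff by (simp add: cg_0_iff mod_eq_dvd_iff)
  qed
  show thesis using that 1 2 by blast
qed

end

section \<open>The linear conditions on the unknown coefficients\<close>

definition bipoly :: "nat \<Rightarrow> nat \<Rightarrow> (nat \<times> nat \<Rightarrow> int) \<Rightarrow> int poly poly" where
  "bipoly L D w = (\<Sum>l<L. monom (\<Sum>d<D. monom (w (l, d)) d) l)"

lemma coeff_bipoly: "coeff (bipoly L D w) l = (if l < L then \<Sum>d<D. monom (w (l, d)) d else 0)"
  by (simp add: bipoly_def coeff_sum)

lemma coeff_sum_monom: "coeff (\<Sum>d<D. monom (w d) d) k = (if k < D then w k else 0)"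
  by (simp add: coeff_sum)

lemma bipoly_diff: "bipoly L D (\<lambda>i. v i - w i) = bipoly L D v - bipoly L D w"
  by (simp add: bipoly_def diff_monom[symmetric] sum_subtractf)

lemma degree_sum_monom: "D > 0 \<Longrightarrow> degree (\<Sum>d<D. monom (w d) d :: int poly) \<le> D - 1"
  by (intro degree_sum_le) (auto intro: order.trans[OF degree_monom_le])

lemma degree_coeff_bipoly: "D > 0 \<Longrightarrow> degree (coeff (bipoly L D w) l) \<le> D - 1"
  using degree_sum_monom[of D] by (simp add: coeff_bipoly)

lemma total_degree_less_bipoly:
  assumes "D > 0"
  shows "total_degree_less (bipoly L D w) (L + D - 1)"
  unfolding total_degree_less_def
proof (intro allI impI)
  fix i assume "coeff (bipoly L D w) i \<noteq> 0"
  then have "i < L" by (auto simp: coeff_bipoly split: if_splits)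
  then show "degree (coeff (bipoly L D w) i) + i < L + D - 1"
    using degree_coeff_bipoly[OF assms, of L w i] assms by linarith
qed

lemma degree_bipoly_less: "L > 0 \<Longrightarrow> degree (bipoly L D w) < L"
  by (rule degree_lessI) (auto simp: coeff_bipoly)

lemma degree_poly_bipoly:
  assumes "D > 0" "L > 0" "degree q \<le> n"
  shows "degree (poly (bipoly L D w) q) \<le> D - 1 + n * (L - 1)"
proof -
  have "poly (bipoly L D w) q = (\<Sum>l<L. (\<Sum>d<D. monom (w (l, d)) d) * q ^ l)"
    by (simp add: bipoly_def poly_sum poly_monom)
  also have "degree \<dots> \<le> D - 1 + n * (L - 1)"
  proof (rule degree_sum_le)
    fix l assume l: "l \<in> {..<L}"
    have "degree (q ^ l) \<le> degree q * l" by (rule degree_power_le)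
    also have "\<dots> \<le> n * (L - 1)" using l assms by (intro mult_le_mono) auto
    finally show "degree ((\<Sum>d<D. monom (w (l, d)) d) * q ^ l) \<le> D - 1 + n * (L - 1)"
      using degree_mult_le[of "\<Sum>d<D. monom (w (l, d)) d" "q ^ l"]
        degree_sum_monom[OF assms(1), of "\<lambda>d. w (l, d)"] by linarith
  qed simp
  finally show ?thesis .
qed

lemma diag_mult: "diag (P * Q) = diag P * diag Q"
  and diag_add: "diag (P + Q) = diag P + diag Q"
  and diag_diff: "diag (P - Q) = diag P - diag Q"
  and diag_power: "diag (P ^ n) = diag P ^ n"
  and diag_const: "diag [:f:] = f"
  and diag_lift: "diag (lift_poly f) = f"
  by (simp_all add: diag_def poly_power poly_lift_poly)

lemma pderiv_funpow_const_mult: "(pderiv ^^ b) ([:g:] * U) = [:g:] * (pderiv ^^ b) (U :: int poly poly)"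
  using higher_pderiv_smult[of b g U] by simp

lemma pderiv_inner_funpow_lift_mult:
  "(pderiv_inner ^^ a) (lift_poly f ^ n * V) = lift_poly f ^ n * (pderiv_inner ^^ a) V"
proof -
  have "pderiv_inner (lift_poly f ^ n) = 0"
    by (cases n) (auto simp: pderiv_inner_power_Suc pderiv_inner_lift pderiv_inner_pCons one_pCons
        simp del: power_Suc)
  then show ?thesis by (induction a) (simp_all add: pderiv_inner_mult)
qed

lemma pderiv_inner_funpow_add:
  "(pderiv_inner ^^ a) (U + V) = (pderiv_inner ^^ a) U + (pderiv_inner ^^ a) V"
  by (induction a) (simp_all add: pderiv_inner_add)

lemma pderiv_inner_funpow_diff:
  "(pderiv_inner ^^ a) (U - V) = (pderiv_inner ^^ a) U - (pderiv_inner ^^ a) V"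
  by (induction a) (simp_all add: pderiv_inner_diff)

lemma pderiv_funpow_diff:
  "(pderiv ^^ a) (U - V) = (pderiv ^^ a) U - (pderiv ^^ a) (V :: int poly poly)"
  by (induction a) (simp_all add: pderiv_diff)

lemma pderiv_funpow_add:
  "(pderiv ^^ a) (U + V) = (pderiv ^^ a) U + (pderiv ^^ a) (V :: int poly poly)"
  by (induction a) (simp_all add: pderiv_add)

text \<open>For b <= a <= e this is what remains on the diagonal of the mixed derivative of f(z)^e U
  + f(x)^e V, a times in z and b times in x, after f^(e - a) is taken out. Its coefficients are the
  equations to be solved.\<close>

definition contact :: "nat \<Rightarrow> int poly \<Rightarrow> nat \<Rightarrow> nat \<Rightarrow> int poly poly \<Rightarrow> int poly poly \<Rightarrow> int poly" where
  "contact e f a b U V = diag (twists (twist_inner e f) a ((pderiv ^^ b) U))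
     + f ^ (a - b) * diag ((pderiv_inner ^^ a) (twists (twist_outer e f) b V))"

lemma contact_diff:
  "contact e f a b (U - U') (V - V') = contact e f a b U V - contact e f a b U' V'"
  by (simp add: contact_def pderiv_funpow_diff twists_inner_diff twists_outer_diff
      pderiv_inner_funpow_diff diag_diff algebra_simps)

lemma diag_deriv_eq_contact:
  assumes "b \<le> a" "a \<le> e"
  shows "diag_deriv a b ([:f:] ^ e * U + lift_poly f ^ e * V) = f ^ (e - a) * contact e f a b U V"
proof -
  have "(pderiv ^^ b) ([:f:] ^ e * U) = [:f:] ^ e * (pderiv ^^ b) U"
    by (simp only: poly_const_pow pderiv_funpow_const_mult)
  then have 1: "diag_deriv a b ([:f:] ^ e * U)
      = f ^ (e - a) * diag (twists (twist_inner e f) a ((pderiv ^^ b) U))"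
    using assms by (simp only: diag_deriv_def pderiv_inner_funpow_twists diag_mult diag_power diag_const)
  have 2: "diag_deriv a b (lift_poly f ^ e * V)
      = f ^ (e - b) * diag ((pderiv_inner ^^ a) (twists (twist_outer e f) b V))"
    using assms by (simp only: diag_deriv_def pderiv_outer_funpow_twists pderiv_inner_funpow_lift_mult
        diag_mult diag_power diag_lift order.trans[OF assms])
  have "f ^ (e - b) = f ^ (e - a) * f ^ (a - b)" using assms by (simp flip: power_add)
  then show ?thesis using 1 2
    by (simp add: diag_deriv_def pderiv_funpow_add pderiv_inner_funpow_add diag_add contact_def algebra_simps)
qed

text \<open>Both summands obey the same degree bound. In the first, a twists add a (2 m - 1) and b
  derivatives subtract b. In the second, b twists add b (2 m - 1), a derivatives subtract a, and
  f^(a - b) adds 2 m (a - b).\<close>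

lemma coeff_contact_eq_0:
  assumes f: "degree f \<le> 2 * m" "m > 0"
    and U: "total_degree_less U K" and V: "total_degree_less V K"
    and ab: "b \<le> a" "a + b \<le> K" and k: "K + 2 * m * a - (a + b) \<le> k"
  shows "coeff (contact e f a b U V) k = 0"
proof -
  obtain m' where m': "2 * m = Suc m'" using f(2) by (cases "2 * m") auto
  have 1: "coeff (diag (twists (twist_inner e f) a ((pderiv ^^ b) U))) k = 0"
  proof (rule coeff_diag_eq_0)
    show "total_degree_less (twists (twist_inner e f) a ((pderiv ^^ b) U)) (K - b + a * m')"
      using f(1) m' by (intro total_degree_less_twists_inner total_degree_less_pderiv_funpow U) simp
    have "2 * m * a = a * m' + a" unfolding m' by simp
    then show "K - b + a * m' \<le> k" using k ab by linarith
  qed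
  have d: "degree (diag ((pderiv_inner ^^ a) (twists (twist_outer e f) b V))) < K + b * m' - a
      \<or> diag ((pderiv_inner ^^ a) (twists (twist_outer e f) b V)) = 0" (is "degree ?W < _ \<or> _")
  proof -
    have "total_degree_less ((pderiv_inner ^^ a) (twists (twist_outer e f) b V)) (K + b * m' - a)"
      using f(1) m' by (intro total_degree_less_twists_outer total_degree_less_pderiv_inner_funpow V) simp
    from coeff_diag_eq_0[OF this] show ?thesis by (metis leading_coeff_0_iff not_le)
  qed
  have "coeff (f ^ (a - b) * ?W) k = 0"
  proof (cases "?W = 0")
    case False
    with d have d: "degree ?W < K + b * m' - a" by simp
    have "degree (f ^ (a - b)) \<le> degree f * (a - b)" by (rule degree_power_le)
    also have "\<dots> \<le> 2 * m * (a - b)" using f(1) by simp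
    finally have "degree (f ^ (a - b) * ?W) < 2 * m * (a - b) + (K + b * m' - a)"
      using degree_mult_le[of "f ^ (a - b)" ?W] d by linarith
    also have "\<dots> = K + 2 * m * a - (a + b)"
    proof -
      have "2 * m * (a - b) + 2 * m * b = 2 * m * a" using ab(1) by (simp flip: distrib_left)
      moreover have "2 * m * b = b * m' + b" unfolding m' by simp
      ultimately show ?thesis using ab by linarith
    qed
    finally show ?thesis using k by (intro coeff_eq_0) simp
  qed simp
  with 1 show ?thesis by (simp add: contact_def)
qed

text \<open>Counts the equations for all orders i < 2 n. The rounded-up halves i - i div 2 sum to
  n^2, and the orders i sum to 2 n^2 - n, which is spread over both sides to avoid a subtraction in
  the total.\<close>

lemma sum_contact_degrees:
  fixes K m :: nat
  assumes "2 * n \<le> K"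
  shows "(\<Sum>i<2*n. K + 2 * m * (i - i div 2) - i) + 2 * n\<^sup>2 = 2 * n * K + 2 * m * n\<^sup>2 + n"
  using assms
proof (induction n)
  case (Suc n)
  have "(\<Sum>i<2 * Suc n. K + 2 * m * (i - i div 2) - i) = (\<Sum>i<2*n. K + 2 * m * (i - i div 2) - i)
      + (K + 2 * m * n - 2 * n) + (K + 2 * m * Suc n - Suc (2 * n))"
    by (simp add: Suc_diff_le)
  then show ?case using Suc by (simp add: algebra_simps power2_eq_square)
qed simp

context prime_modulus
begin

text \<open>The two boxes of coefficients differ so that everything balances: U and V both have
  total degree below h + r, and, for p = 2 r + 1, both parts of U(z^p, z) + \<epsilon> f^r V(z^p, z)
  get the same degree bound. The exponent r + 1 then acts as 1/2 modulo p, because 2 (r + 1) = p +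
  1.\<close>

lemma auxiliary_polynomials:
  assumes f: "degree f \<le> 2 * m" "m > 0" and h: "h > 0" and r: "m + h + 2 * h\<^sup>2 \<le> r + 1"
  obtains u v where
    "\<not> (bipoly (m + h) (r + 1 - m) u \<doteq> 0 \<and> bipoly h (r + 1) v \<doteq> 0)"
    "\<And>a b. a + b < 2 * h \<Longrightarrow> diag_deriv a b ([:f:] ^ (r + 1) * bipoly (m + h) (r + 1 - m) u
        + lift_poly f ^ (r + 1) * bipoly h (r + 1) v) \<doteq> 0"
proof -
  define N where "N i = h + r + 2 * m * (i - i div 2) - i" for i
  define I where "I = ({..<m + h} \<times> {..<r + 1 - m}) <+> ({..<h} \<times> {..<r + 1})"
  define J where "J = Sigma {..<2*h} (\<lambda>i. {..<N i})"
  define U where "U w = bipoly (m + h) (r + 1 - m) (w \<circ> Inl)" for w :: "(nat \<times> nat) + (nat \<times> nat) \<Rightarrow> int"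
  define V where "V w = bipoly h (r + 1) (w \<circ> Inr)" for w :: "(nat \<times> nat) + (nat \<times> nat) \<Rightarrow> int"
  define \<phi> where "\<phi> w j = coeff (contact (r + 1) f (fst j - fst j div 2) (fst j div 2) (U w) (V w)) (snd j)"
    for w j
  obtain t where t: "r + 1 = m + h + 2 * h\<^sup>2 + t" using r le_Suc_ex by blast
  have hh: "2 * h \<le> h + r" using t f(2) by linarith
  have fin: "finite I" "finite J" by (auto simp: I_def J_def)
  have "card J = (\<Sum>i<2*h. N i)" by (simp add: J_def)
  moreover have "(\<Sum>i<2*h. N i) + 2 * h\<^sup>2 = 2 * h * (h + r) + 2 * m * h\<^sup>2 + h"
    unfolding N_def by (rule sum_contact_degrees[OF hh])
  ultimately have J: "card J + h = 2 * h * (r + 1) + 2 * m * h\<^sup>2"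
    by (simp add: power2_eq_square algebra_simps)
  have rm: "r + 1 - m = h + 2 * h\<^sup>2 + t" using t by simp
  have "card I = (m + h) * (r + 1 - m) + h * (r + 1)"
    unfolding I_def by (simp add: card_Plus)
  then have "card I = (m + h) * (h + 2 * h\<^sup>2 + t) + h * (r + 1)"
    unfolding rm .
  \<comment> \<open>The surplus of unknowns over equations is m t + h; the lower bound on r is what
    makes t nonnegative.\<close>
  then have "card J < card I" using J h unfolding t by (simp add: algebra_simps power2_eq_square)
  moreover have "\<phi> (\<lambda>i. v i - w i) j = \<phi> v j - \<phi> w j" for v w j
    by (simp add: \<phi>_def U_def V_def comp_def bipoly_diff contact_diff)
  ultimately obtain w where w: "\<exists>i\<in>I. \<not> w i \<doteq> 0" "\<forall>j\<in>J. \<phi> w j \<doteq> 0"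
    using pigeonhole_kernel[OF fin] by metis
  have "\<not> (U w \<doteq> 0 \<and> V w \<doteq> 0)"
  proof
    assume *: "U w \<doteq> 0 \<and> V w \<doteq> 0"
    from w(1) obtain i where i: "i \<in> I" "\<not> w i \<doteq> 0" by blast
    show False
    proof (cases i)
      case (Inl x)
      then have "fst x < m + h" "snd x < r + 1 - m" using i by (auto simp: I_def)
      then have "coeff (coeff (U w) (fst x)) (snd x) = w i"
        by (simp add: U_def coeff_bipoly coeff_sum_monom Inl)
      then show False using * i(2) unfolding cg_poly_iff by (metis coeff_0)
    next
      case (Inr x)
      then have "fst x < h" "snd x < r + 1" using i by (auto simp: I_def)
      then have "coeff (coeff (V w) (fst x)) (snd x) = w i"
        by (simp add: V_def coeff_bipoly coeff_sum_monom Inr)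
      then show False using * i(2) unfolding cg_poly_iff by (metis coeff_0)
    qed
  qed
  moreover have "diag_deriv a b ([:f:] ^ (r + 1) * U w + lift_poly f ^ (r + 1) * V w) \<doteq> 0"
    if "a + b < 2 * h" for a b
  proof (rule diag_deriv_all_cg_0[OF _ that])
    fix i assume i: "i < 2 * h"
    \<comment> \<open>The most even split of i derivatives; the count in z is rounded up because
      \<open>diag_deriv_eq_contact\<close> asks for b <= a.\<close>
    let ?a = "i - i div 2" and ?b = "i div 2"
    have "contact (r + 1) f ?a ?b (U w) (V w) \<doteq> 0"
      unfolding cg_poly_iff coeff_0
    proof
      fix k
      show "coeff (contact (r + 1) f ?a ?b (U w) (V w)) k \<doteq> 0"
      proof (cases "k < N i")
        case True
        then have "(i, k) \<in> J" using i by (simp add: J_def)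
        with w(2) show ?thesis by (auto simp: \<phi>_def)
      next
        case False
        have "coeff (contact (r + 1) f ?a ?b (U w) (V w)) k = 0"
        proof (rule coeff_contact_eq_0[OF f])
          have "total_degree_less (U w) (m + h + (r + 1 - m) - 1)"
            unfolding U_def using rm h by (intro total_degree_less_bipoly) simp
          then show "total_degree_less (U w) (h + r)" using t by (simp add: algebra_simps)
          have "total_degree_less (V w) (h + (r + 1) - 1)"
            unfolding V_def by (intro total_degree_less_bipoly) simp
          then show "total_degree_less (V w) (h + r)" by simp
          show "?b \<le> ?a" by simp
          show "?a + ?b \<le> h + r" using i hh by simp
          show "h + r + 2 * m * ?a - (?a + ?b) \<le> k" using False by (simp add: N_def)
        qed
        then show ?thesis by simp
      qed
    qed
    moreover have "?b \<le> ?a" "?a \<le> r + 1" using i hh by auto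
    ultimately show "?b \<le> i \<and> diag_deriv ?a ?b ([:f:] ^ (r + 1) * U w + lift_poly f ^ (r + 1) * V w) \<doteq> 0"
      by (simp add: diag_deriv_eq_contact cg_mult_0 del: power_Suc)
  qed
  ultimately show thesis using that unfolding U_def V_def by blast
qed

end

section \<open>The bound of Stepanov\<close>

lemma poly_poly_const: "poly (poly R q) b = poly (poly R [:poly q b:]) (b :: 'a :: comm_ring_1)"
  by (induction R) simp_all

context prime_modulus
begin

lemma cg_poly_arg: "q \<doteq> q' \<Longrightarrow> poly R q \<doteq> poly R q'"
  by (induction R) (auto intro: cg_add cg_mult)

text \<open>Modulo p the derivative of z^p is 0, so x = z^p behaves like a constant and only the
  derivative in z survives.\<close>

lemma pderiv_funpow_poly_frobenius:
  "(pderiv ^^ i) (poly P (monom 1 p)) \<doteq> poly ((pderiv_inner ^^ i) P) (monom 1 p)"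
proof (induction i)
  case (Suc i)
  have "pderiv (monom (1::int) p) \<doteq> 0"
    by (simp add: pderiv_monom cg_poly_iff)
  then have "poly (pderiv ((pderiv_inner ^^ i) P)) (monom 1 p) * pderiv (monom 1 p) \<doteq> 0"
    by (rule cg_mult_0)
  then have "pderiv (poly ((pderiv_inner ^^ i) P) (monom 1 p))
      \<doteq> poly ((pderiv_inner ^^ Suc i) P) (monom 1 p) + 0"
    unfolding pderiv_poly_chain funpow.simps comp_def by (intro cg_add cg_refl)
  with cg_pderiv[OF Suc] show ?case by (auto intro: cg_trans)
qed simp

lemma poly_frobenius_diag:
  "poly (poly P (monom 1 p)) a \<doteq> poly (diag P) a"
proof -
  have "poly (monom 1 p) a \<doteq> a" by (simp add: poly_monom frobenius_int)
  then have "poly P [:poly (monom 1 p) a:] \<doteq> poly P [:poly [:0, 1:] a:]"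
    by (intro cg_poly_arg cg_const) simp
  then have "poly (poly P [:poly (monom 1 p) a:]) a \<doteq> poly (poly P [:poly [:0, 1:] a:]) a"
    by (rule cg_poly)
  then show ?thesis unfolding diag_def by (simp only: poly_poly_const[symmetric])
qed

text \<open>Multiplying by f^(r + 1) turns f^r V into f^p V, that is f(z^p) V, so the product is
  P(z^p, z) with P = f(z)^(r + 1) U + \<epsilon> f(x) V. At the residue a, z^p takes the same value
  as z and \<epsilon> f(a) equals f(a)^(r + 1), so the derivatives of P in z are those controlled by
  the hypothesis.\<close>

lemma vanishing_order:
  assumes p: "p = 2 * r + 1" and n: "n \<le> p"
    and dd: "\<And>a b. a + b < n \<Longrightarrow> diag_deriv a b ([:f:] ^ (r + 1) * U + lift_poly f ^ (r + 1) * V) \<doteq> 0"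
    and a: "poly f a ^ r \<doteq> \<epsilon>" and \<epsilon>: "\<epsilon> * \<epsilon> = 1"
  shows "\<exists>H. poly U (monom 1 p) + smult \<epsilon> (f ^ r) * poly V (monom 1 p) \<doteq> [:-a, 1:] ^ n * H"
proof -
  let ?q = "monom 1 p :: int poly"
  let ?F = "poly U ?q + smult \<epsilon> (f ^ r) * poly V ?q"
  \<comment> \<open>The exponent 1 is written out so that
    \<open>pderiv_inner_funpow_lift_mult\<close> applies to the second term.\<close>
  define P where "P = [:f:] ^ (r + 1) * U + (lift_poly f * [:[:\<epsilon>:]:]) ^ 1 * V"
  have lift: "lift_poly f * [:[:\<epsilon>:]:] = lift_poly (f * [:\<epsilon>:])"
    by (simp add: map_poly_smult[of "\<lambda>c. [:c:]" ] )
  have "poly P ?q = f ^ (r + 1) * poly U ?q + smult \<epsilon> (pcompose f ?q) * poly V ?q"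
    by (simp add: P_def poly_lift_poly del: power_Suc)
  also have "\<dots> \<doteq> f ^ (r + 1) * poly U ?q + smult \<epsilon> (f ^ p) * poly V ?q"
    using cg_sym[OF frobenius_poly[of f]]
    by (intro cg_add cg_mult cg_refl) (auto simp: cg_poly_iff intro!: cg_mult)
  also have "f ^ (r + 1) * poly U ?q + smult \<epsilon> (f ^ p) * poly V ?q = ?F * f ^ (r + 1)"
  proof -
    have "f ^ p = f ^ (r + 1) * f ^ r" by (subst p) (simp add: mult_2 flip: power_add)
    then show ?thesis by (simp add: algebra_simps)
  qed
  finally have PF: "poly P ?q \<doteq> ?F * f ^ (r + 1)" .
  have "poly ((pderiv ^^ i) (?F * f ^ (r + 1))) a \<doteq> 0" if i: "i < n" for i
  proof -
    have "poly ((pderiv ^^ i) (?F * f ^ (r + 1))) a \<doteq> poly ((pderiv ^^ i) (poly P ?q)) a"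
      by (rule cg_poly[OF cg_pderiv_funpow[OF cg_sym[OF PF]]])
    also have "\<dots> \<doteq> poly (poly ((pderiv_inner ^^ i) P) ?q) a"
      by (rule cg_poly[OF pderiv_funpow_poly_frobenius])
    also have "\<dots> \<doteq> poly (diag ((pderiv_inner ^^ i) P)) a" by (rule poly_frobenius_diag)
    also have "\<dots> = poly (diag ((pderiv_inner ^^ i) ([:f:] ^ (r + 1) * U))) a
        + \<epsilon> * poly f a * poly (diag ((pderiv_inner ^^ i) V)) a"
      unfolding P_def pderiv_inner_funpow_add lift pderiv_inner_funpow_lift_mult
      by (simp add: diag_add diag_mult diag_power diag_lift del: power_Suc)
    also have "\<dots> \<doteq> poly (diag ((pderiv_inner ^^ i) ([:f:] ^ (r + 1) * U))) a
        + poly f a ^ (r + 1) * poly (diag ((pderiv_inner ^^ i) V)) a"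
      using cg_mult[OF cg_sym[OF a] cg_refl[of "poly f a"]]
      by (intro cg_add cg_mult cg_refl) (simp add: mult_ac)
    also have "\<dots> = poly (diag_deriv i 0 ([:f:] ^ (r + 1) * U + lift_poly f ^ (r + 1) * V)) a"
      by (simp add: diag_deriv_def pderiv_inner_funpow_add pderiv_inner_funpow_lift_mult
          diag_add diag_mult diag_power diag_lift del: power_Suc)
    also have "\<dots> \<doteq> 0" using cg_poly[OF dd[of i 0], of a] i by simp
    finally show ?thesis .
  qed
  from power_linear_dvd_of_pderiv[of n, OF this n]
  obtain H where H: "?F * f ^ (r + 1) \<doteq> [:-a, 1:] ^ n * H" by blast
  have "\<not> poly (f ^ (r + 1)) a \<doteq> 0"
  proof
    assume "poly (f ^ (r + 1)) a \<doteq> 0"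
    then have "poly f a \<doteq> 0" using cg_power_0_int by (metis poly_power)
    then have "\<epsilon> * \<epsilon> \<doteq> 0 \<or> r = 0"
      using cg_trans[OF cg_sym[OF a] cg_power[of "poly f a" 0 r]]
      by (cases r) (auto intro: cg_mult_0)
    moreover have "r \<noteq> 0" using prime_gt_1_nat[OF prime_p] p by auto
    ultimately show False using \<epsilon> not_cg_1 by simp
  qed
  from power_linear_dvd_cofactor[OF H this] show ?thesis .
qed

text \<open>Base p expansion: for d < p the exponent l p + d determines l and d, so the substitution
  x = z^p merely relabels the coefficients.\<close>

lemma poly_frobenius_eq_0:
  assumes deg: "\<And>l. degree (coeff P l) < p" and P: "poly P (monom 1 p) \<doteq> (0 :: int poly)"
  shows "P \<doteq> 0"
  unfolding cg_poly_iff[of P] 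
proof
  fix l
  show "coeff P l \<doteq> coeff 0 l"
    unfolding cg_poly_iff
  proof
    fix d
    show "coeff (coeff P l) d \<doteq> coeff (coeff 0 l) d"
    proof (cases "d < p \<and> l \<le> degree P")
      case False
      have "coeff (coeff P l) d = 0"
      proof (cases "d < p")
        case True then show ?thesis using False by (simp add: coeff_eq_0)
      next
        case False then show ?thesis using deg[of l] by (intro coeff_eq_0) simp
      qed
      then show ?thesis by simp
    next
      case True
      have "coeff (poly P (monom 1 p)) (l * p + d)
          = (\<Sum>i\<le>degree P. coeff (coeff P i * monom 1 (p * i)) (l * p + d))"
        by (simp add: poly_altdef coeff_sum monom_power)
      also have "\<dots> = (\<Sum>i\<le>degree P. if i = l then coeff (coeff P l) d else 0)"
      proof (intro sum.cong refl)
        fix i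
        have "coeff (coeff P i * monom 1 (p * i)) (l * p + d)
            = (if p * i \<le> l * p + d then coeff (coeff P i) (l * p + d - p * i) else 0)"
          by (subst mult.commute) (simp add: coeff_monom_mult)
        also have "\<dots> = (if i = l then coeff (coeff P l) d else 0)"
        proof (cases i l rule: linorder_cases)
          case less
          then have "p * i + p \<le> l * p" by (metis Suc_leI mult.commute mult_Suc_right mult_le_mono1 add.commute)
          then have "degree (coeff P i) < l * p + d - p * i" using deg[of i] by linarith
          then show ?thesis using less by (simp add: coeff_eq_0)
        next
          case greater
          then have "l * p + p \<le> p * i" by (metis Suc_leI mult.commute mult_Suc_right mult_le_mono1 add.commute)
          then show ?thesis using greater True by auto
        qed (simp add: mult.commute)
        finally show "coeff (coeff P i * monom 1 (p * i)) (l * p + d) = (if i = l then coeff (coeff P l) d else 0)" .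
      qed
      also have "\<dots> = coeff (coeff P l) d" using True by simp
      finally show ?thesis using P unfolding cg_poly_iff by (metis coeff_0)
    qed
  qed
qed

text \<open>For each d, the coefficients of z^d form a polynomial in x of degree below p that has p
  roots modulo p.\<close>

lemma poly_specialisations_eq_0:
  fixes U :: "int poly poly"
  assumes deg: "degree U < p" and U: "\<And>a. poly U [:a:] \<doteq> 0"
  shows "U \<doteq> 0"
  unfolding cg_poly_iff[of U] 
proof
  fix l
  show "coeff U l \<doteq> coeff 0 l"
    unfolding cg_poly_iff
  proof
    fix d
    define u where "u = map_poly (\<lambda>c. coeff c d) U"
    have pu: "poly u a = coeff (poly U [:a:]) d" for a
      unfolding u_def by (induction U) (simp_all add: map_poly_pCons)
    have "u \<doteq> 0"
    proof (rule ccontr)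
      assume nz: "\<not> u \<doteq> 0"
      have "1 * card {0..<int p} \<le> degree u"
      proof (rule count_roots[OF _ _ _ nz])
        fix a assume "a \<in> {0..<int p}"
        have "poly u a \<doteq> 0" using U[of a] unfolding pu cg_poly_iff by simp
        then show "\<exists>h. u \<doteq> [:- a, 1:] ^ 1 * h" using linear_factor by simp
      qed auto
      also have "degree u \<le> degree U" unfolding u_def by (rule map_poly_degree_leq) 
      finally show False using deg by simp
    qed
    then have "coeff u l \<doteq> 0" unfolding cg_poly_iff by simp
    then show "coeff (coeff U l) d \<doteq> coeff (coeff 0 l) d" by (simp add: u_def coeff_map_poly)
  qed
qed

lemma degree_coeff_mult_le:
  assumes "\<And>i. degree (coeff P i) \<le> m" "\<And>i. degree (coeff Q i) \<le> n"
  shows "degree (coeff (P * Q) i) \<le> m + (n::nat)"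
  unfolding coeff_mult
proof (rule degree_sum_le)
  fix j
  show "degree (coeff P j * coeff Q (i - j)) \<le> m + n"
    using degree_mult_le[of "coeff P j" "coeff Q (i - j)"] assms(1)[of j] assms(2)[of "i - j"] by linarith
qed simp

text \<open>With denominators cleared: modulo p, f is not a constant times the square of a rational
  function. The case \<open>\<kappa>\<close> = 0 also forces f to be nonzero.\<close>

definition never_square :: "int poly \<Rightarrow> bool" where
  "never_square f \<longleftrightarrow> (\<forall>A B \<kappa>. f * A\<^sup>2 \<doteq> [:\<kappa>:] * B\<^sup>2 \<longrightarrow> A \<doteq> 0)"

text \<open>If the auxiliary polynomial vanished, squaring would give f(z) U^2 = f(x) V^2 at x =
  z^p; as the z-degrees are at most 2 r < p, this is an identity in x and z. At each constant x = a,
  \<open>never_square\<close> then forces U(a, z) = 0, so U vanishes and with it V.\<close>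

lemma auxiliary_nonzero:
  assumes p: "p = 2 * r + 1" and f: "never_square f" "degree f \<le> 2 * m" "m \<le> r" and L: "0 < L" "L < p"
    and \<epsilon>: "\<epsilon> * \<epsilon> = 1"
    and U_def: "U = bipoly L (r + 1 - m) u" and V_def: "V = bipoly h (r + 1) v"
    and F: "poly U (monom 1 p) + smult \<epsilon> (f ^ r) * poly V (monom 1 p) \<doteq> 0"
  shows "U \<doteq> 0 \<and> V \<doteq> 0"
proof -
  let ?q = "monom 1 p :: int poly"
  define P where "P = [:f:] * U\<^sup>2 - lift_poly f * V\<^sup>2"
  have f0: "\<not> f \<doteq> 0"
  proof
    assume "f \<doteq> 0"
    then have "f * 1\<^sup>2 \<doteq> [:0:] * 0\<^sup>2" by simp
    then have "(1::int poly) \<doteq> 0" using f(1) unfolding never_square_def by blast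
    then show False using monic_not_cg_0[of 1] by simp
  qed
  have "poly U ?q \<doteq> - (smult \<epsilon> (f ^ r) * poly V ?q)"
    using F by (simp add: cg_def)
  then have "(poly U ?q)\<^sup>2 \<doteq> (- (smult \<epsilon> (f ^ r) * poly V ?q))\<^sup>2" by (rule cg_power)
  then have "f * (poly U ?q)\<^sup>2 \<doteq> f * (- (smult \<epsilon> (f ^ r) * poly V ?q))\<^sup>2"
    by (intro cg_mult cg_refl)
  also have "f * (- (smult \<epsilon> (f ^ r) * poly V ?q))\<^sup>2 = f ^ p * (poly V ?q)\<^sup>2"
    using \<epsilon> unfolding p by (simp add: power2_eq_square power_add power_mult mult_ac)
  also have "\<dots> \<doteq> pcompose f ?q * (poly V ?q)\<^sup>2" by (intro cg_mult frobenius_poly cg_refl)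
  finally have "poly P ?q \<doteq> 0" by (simp add: P_def poly_lift_poly cg_def)
  moreover have "degree (coeff P l) < p" for l
  proof -
    have "degree (coeff U i) \<le> r - m" for i
      unfolding U_def using degree_coeff_bipoly[of "r + 1 - m"] f(3) by (simp add: Suc_diff_le)
    then have "degree (coeff (U * U) i) \<le> (r - m) + (r - m)" for i by (intro degree_coeff_mult_le)
    then have "degree (coeff ([:f:] * (U * U)) l) \<le> 2 * m + ((r - m) + (r - m))"
      using f(2) by (intro degree_coeff_mult_le[of "[:f:]"]) (auto simp: coeff_pCons split: nat.splits)
    then have 1: "degree (coeff ([:f:] * U\<^sup>2) l) \<le> 2 * r" using f(3) by (simp add: power2_eq_square)
    have "degree (coeff V i) \<le> r" for i
      unfolding V_def using degree_coeff_bipoly[of "r + 1"] by simp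
    then have "degree (coeff (V * V) i) \<le> r + r" for i by (intro degree_coeff_mult_le)
    then have "degree (coeff (lift_poly f * (V * V)) l) \<le> 0 + (r + r)"
      by (intro degree_coeff_mult_le[of "lift_poly f"]) (auto simp: coeff_map_poly)
    then have 2: "degree (coeff (lift_poly f * V\<^sup>2) l) \<le> 2 * r" by (simp add: power2_eq_square)
    show ?thesis unfolding P_def coeff_diff p
      using degree_diff_le[OF 1 2] by simp
  qed
  ultimately have P0: "P \<doteq> 0" by (intro poly_frobenius_eq_0)
  have U0: "U \<doteq> 0"
  proof (rule poly_specialisations_eq_0)
    show "degree U < p" using degree_bipoly_less[OF L(1)] L(2) unfolding U_def by (rule less_trans)
    fix a
    from P0 have "poly P [:a:] \<doteq> 0" using cg_poly by fastforce
    then have "f * (poly U [:a:])\<^sup>2 \<doteq> [:poly f a:] * (poly V [:a:])\<^sup>2"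
      by (simp add: P_def poly_lift_poly pcompose_pCons_0 cg_def)
    then show "poly U [:a:] \<doteq> 0" using f(1) unfolding never_square_def by blast
  qed
  have "[:f:] * U\<^sup>2 - P \<doteq> [:f:] * (U * 0) - 0" unfolding power2_eq_square
    by (intro cg_diff cg_mult cg_refl U0 P0)
  then have "lift_poly f * V\<^sup>2 \<doteq> 0" by (simp add: P_def)
  moreover have "\<not> lift_poly f \<doteq> 0"
  proof
    assume "lift_poly f \<doteq> 0"
    then have "coeff (coeff (lift_poly f) i) 0 \<doteq> 0" for i unfolding cg_poly_iff by simp
    then have "f \<doteq> 0" unfolding cg_poly_iff by (simp add: coeff_map_poly)
    with f0 show False by simp
  qed
  ultimately have "V \<doteq> 0" using cg_mult_0_poly2[of "lift_poly f" "V\<^sup>2"] cg_mult_0_poly2[of V V]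
    by (auto simp: power2_eq_square)
  with U0 show ?thesis by simp
qed

text \<open>Every counted residue is a zero of order 2 h of a polynomial that is nonzero modulo p,
  so its degree bounds their number.\<close>

lemma stepanov_bound:
  assumes p: "p = 2 * r + 1" and f: "never_square f" "degree f \<le> 2 * m" "m > 0"
    and h: "h > 0" and r: "m + h + 2 * h\<^sup>2 \<le> r + 1" and \<epsilon>: "\<epsilon> * \<epsilon> = 1"
  shows "2 * h * card {t \<in> {0..<int p}. poly f t ^ r \<doteq> \<epsilon>} \<le> p * (m + h - 1) + r - m"
proof -
  let ?q = "monom 1 p :: int poly"
  let ?T = "{t \<in> {0..<int p}. poly f t ^ r \<doteq> \<epsilon>}"
  from auxiliary_polynomials[OF f(2,3) h r] obtain u v where
    uv: "\<not> (bipoly (m + h) (r + 1 - m) u \<doteq> 0 \<and> bipoly h (r + 1) v \<doteq> 0)"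
    and dd: "\<And>a b. a + b < 2 * h \<Longrightarrow> diag_deriv a b ([:f:] ^ (r + 1) * bipoly (m + h) (r + 1 - m) u
        + lift_poly f ^ (r + 1) * bipoly h (r + 1) v) \<doteq> 0" by metis
  let ?U = "bipoly (m + h) (r + 1 - m) u" and ?V = "bipoly h (r + 1) v"
  let ?F = "poly ?U ?q + smult \<epsilon> (f ^ r) * poly ?V ?q"
  have mhr: "m + h < r" "h \<le> h\<^sup>2"
  proof -
    show "h \<le> h\<^sup>2" by (simp add: power2_eq_square)
    then show "m + h < r" using h r by linarith
  qed
  have "\<not> ?F \<doteq> 0"
    using auxiliary_nonzero[OF p f(1,2) _ _ _ \<epsilon> refl refl, of "m + h" u h v] uv f(3) mhr p by auto
  moreover have "\<exists>H. ?F \<doteq> [:-a, 1:] ^ (2 * h) * H" if "a \<in> ?T" for a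
    using that mhr p by (intro vanishing_order[OF p _ dd _ \<epsilon>]) auto
  ultimately have "2 * h * card ?T \<le> degree ?F"
    by (intro count_roots finite_subset[of ?T "{0..<int p}"]) auto
  also have "degree ?F \<le> p * (m + h - 1) + r - m"
  proof (rule degree_add_le)
    have q: "degree ?q \<le> p" by (rule degree_monom_le)
    have "degree (poly ?U ?q) \<le> (r + 1 - m) - 1 + p * (m + h - 1)"
      using mhr h by (intro degree_poly_bipoly q) auto
    then show "degree (poly ?U ?q) \<le> p * (m + h - 1) + r - m" using mhr by simp
    have "degree (smult \<epsilon> (f ^ r)) \<le> degree f * r"
      using degree_smult_le degree_power_le order.trans by blast
    also have "\<dots> \<le> 2 * m * r" using f(2) by simp
    finally have "degree (smult \<epsilon> (f ^ r)) \<le> 2 * m * r" .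
    moreover have "degree (poly ?V ?q) \<le> (r + 1) - 1 + p * (h - 1)"
      using h by (intro degree_poly_bipoly q) auto
    ultimately have "degree (smult \<epsilon> (f ^ r) * poly ?V ?q) \<le> 2 * m * r + (r + p * (h - 1))"
      using degree_mult_le[of "smult \<epsilon> (f ^ r)" "poly ?V ?q"] by simp
    \<comment> \<open>Since p m = 2 m r + m, the degree bound of the V part agrees with that of the
      U part.\<close>
    also have "\<dots> = p * (m + h - 1) + r - m"
    proof -
      obtain k where k: "h = Suc k" using h by (cases h) auto
      show ?thesis unfolding k p by (simp add: algebra_simps)
    qed
    finally show "degree (smult \<epsilon> (f ^ r) * poly ?V ?q) \<le> p * (m + h - 1) + r - m" .
  qed
  finally show ?thesis .
qed

end

section \<open>Legendre symbol sums\<close>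

context prime_modulus
begin

lemma inverse_cg: assumes "\<not> (a::int) \<doteq> 0" shows "\<exists>b. a * b \<doteq> 1"
proof -
  have "coprime a (int p)" using assms prime_p unfolding cg_0_iff
    by (metis coprime_commute prime_imp_coprime prime_nat_int_transfer)
  then show ?thesis using cong_solve_coprime_int unfolding cg_int_iff by blast
qed

lemma cg_pcompose_arg: "q \<doteq> q' \<Longrightarrow> pcompose X q \<doteq> pcompose (X :: int poly) q'"
  unfolding pcompose_altdef by (rule cg_poly_arg)

lemma dvd_diff_pcompose: "q - q' dvd pcompose X q - pcompose (X :: int poly) q'"
proof (induction X)
  case (pCons a X)
  have "pcompose (pCons a X) q - pcompose (pCons a X) q'
      = (q - q') * pcompose X q + q' * (pcompose X q - pcompose X q')"
    by (simp add: pcompose_pCons algebra_simps)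
  then show ?case using pCons by (simp add: dvd_add dvd_mult)
qed simp

lemma fermat_int: assumes "\<not> (a::int) \<doteq> 0" shows "a ^ (p - 1) \<doteq> 1"
proof -
  obtain b where b: "a * b \<doteq> 1" using inverse_cg[OF assms] by blast
  have "a ^ (p - 1) * 1 \<doteq> a ^ (p - 1) * (a * b)" by (intro cg_mult cg_refl cg_sym[OF b])
  also have "a ^ (p - 1) * (a * b) = a ^ p * b"
    using prime_gt_0_nat[OF prime_p] by (cases p) (simp_all add: mult_ac)
  also have "\<dots> \<doteq> a * b" by (intro cg_mult frobenius_int cg_refl)
  also note b
  finally show ?thesis by simp
qed

text \<open>
  Modulo \<open>z ^ d + c\<close> the Frobenius map acts as \<open>z \<mapsto> \<omega> z\<close> with \<open>\<omega> ^ d = 1\<close>,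
  which is injective; so there are no nilpotent residues.
\<close>

lemma binomial_dvd_square:
  assumes d: "d > 0" "d dvd p - 1" and c: "\<not> c \<doteq> 0" 
    and X: "X\<^sup>2 \<doteq> (monom 1 d + [:c:]) * H"
  shows "\<exists>H. X \<doteq> (monom 1 d + [:c:]) * (H :: int poly)"
proof -
  define g where "g = monom 1 d + [:c:]"
  define \<gamma> where "\<gamma> = - c"
  obtain e where e: "p - 1 = d * e" using d(2) by blast
  define \<omega> where "\<omega> = \<gamma> ^ e"
  have p2: "p \<ge> 2" using prime_ge_2_nat[OF prime_p] .
  have "\<not> \<gamma> \<doteq> 0" using c by (simp add: \<gamma>_def cg_0_iff)
  then have \<omega>d: "\<omega> ^ d \<doteq> 1"
    using fermat_int[of \<gamma>] unfolding \<omega>_def e by (simp add: power_mult[symmetric] mult.commute)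
  \<comment> \<open>With p - 1 = d e both sides are z ((z^d)^e - \<open>\<gamma>\<close>^e), and g =
    z^d - \<open>\<gamma>\<close> divides this difference of e-th powers.\<close>
  have "monom (1::int) p - monom \<omega> 1 = monom 1 1 * ((g + [:\<gamma>:]) ^ e - [:\<gamma>:] ^ e)"
  proof -
    have "(g + [:\<gamma>:]) ^ e = monom 1 (p - 1)" unfolding e by (simp add: g_def \<gamma>_def monom_power add.assoc)
    moreover have "monom (1::int) 1 * monom 1 (p - 1) = monom 1 p" using p2 by (simp add: mult_monom)
    moreover have "monom 1 1 * [:\<gamma>:] ^ e = monom \<omega> 1" 
      by (simp add: poly_const_pow \<omega>_def smult_monom)
    ultimately show ?thesis by (simp add: right_diff_distrib)
  qed
  moreover have "g dvd (g + [:\<gamma>:]) ^ e - [:\<gamma>:] ^ e"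
    using power_diff_sumr2[of "g + [:\<gamma>:]" e "[:\<gamma>:]"] by simp
  ultimately have "g dvd monom (1::int) p - monom \<omega> 1" by simp
  then have "g dvd pcompose X (monom 1 p) - pcompose X (monom \<omega> 1)"
    using dvd_diff_pcompose dvd_trans by blast
  then obtain K where K: "pcompose X (monom 1 p) - pcompose X (monom \<omega> 1) = g * K" by blast
  \<comment> \<open>X^p contains the factor X^2, so modulo p the polynomial g divides X(z^p) and
    therefore X(\<open>\<omega>\<close> z).\<close>
  have "X ^ p = X\<^sup>2 * X ^ (p - 2)" using p2 by (metis le_add_diff_inverse power_add)
  also have "\<dots> \<doteq> g * H * X ^ (p - 2)" using X by (intro cg_mult cg_refl) (simp add: g_def)
  finally have "pcompose X (monom 1 p) \<doteq> g * H * X ^ (p - 2)"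
    using cg_sym[OF frobenius_poly[of X]] cg_trans by blast
  then have "pcompose X (monom 1 p) - g * K \<doteq> g * H * X ^ (p - 2) - g * K" by (intro cg_diff cg_refl)
  also have "g * H * X ^ (p - 2) - g * K = g * (H * X ^ (p - 2) - K)" by (simp add: algebra_simps)
  finally have "pcompose X (monom \<omega> 1) \<doteq> g * (H * X ^ (p - 2) - K)" using K by (simp add: algebra_simps)
  \<comment> \<open>Scaling z by \<open>\<omega>\<close>^(d - 1) undoes the scaling by
    \<open>\<omega>\<close> and fixes g modulo p, both because \<open>\<omega>\<close>^d is 1 modulo
    p.\<close>
  then have "pcompose (pcompose X (monom \<omega> 1)) (monom (\<omega> ^ (d - 1)) 1)
      \<doteq> pcompose (g * (H * X ^ (p - 2) - K)) (monom (\<omega> ^ (d - 1)) 1)" by (rule cg_pcompose)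
  also have "\<dots> = pcompose g (monom (\<omega> ^ (d - 1)) 1)
      * pcompose (H * X ^ (p - 2) - K) (monom (\<omega> ^ (d - 1)) 1)" by (rule pcompose_mult)
  also have "\<dots> \<doteq> g * pcompose (H * X ^ (p - 2) - K) (monom (\<omega> ^ (d - 1)) 1)"
  proof (intro cg_mult cg_refl)
    have m: "pcompose (monom a n) (monom b 1) = monom (a * b ^ n) n" for a b :: int and n
      by (simp add: pcompose_altdef map_poly_monom poly_monom monom_power smult_monom)
    have "(\<omega> ^ (d - 1)) ^ d \<doteq> 1" using cg_power[OF \<omega>d, of "d - 1"]
      by (simp add: power_mult[symmetric] mult.commute)
    then have "monom ((\<omega> ^ (d - 1)) ^ d) d \<doteq> monom 1 d" by (simp add: cg_poly_iff)
    then show "pcompose g (monom (\<omega> ^ (d - 1)) 1) \<doteq> g"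
      unfolding g_def pcompose_add m pcompose_const by (intro cg_add cg_refl) simp
  qed
  finally have 1: "pcompose (pcompose X (monom \<omega> 1)) (monom (\<omega> ^ (d - 1)) 1)
      \<doteq> g * pcompose (H * X ^ (p - 2) - K) (monom (\<omega> ^ (d - 1)) 1)" .
  have "pcompose (pcompose X (monom \<omega> 1)) (monom (\<omega> ^ (d - 1)) 1) = pcompose X (monom (\<omega> * \<omega> ^ (d - 1)) 1)"
    by (simp add: pcompose_assoc[symmetric] monom_Suc monom_0 pcompose_pCons)
  also have "\<omega> * \<omega> ^ (d - 1) = \<omega> ^ d" using d(1) by (cases d) auto
  also have "pcompose X (monom (\<omega> ^ d) 1) \<doteq> pcompose X (monom 1 1)"
    using \<omega>d by (intro cg_pcompose_arg) (simp add: cg_poly_iff)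
  also have "pcompose X (monom 1 1) = X" by (simp add: monom_Suc monom_0)
  finally show ?thesis using 1 cg_sym cg_trans unfolding g_def by blast
qed

text \<open>Used with g = z^d + c: each other factor z^d + x is the constant x - c modulo g, so
  their product will be a unit there.\<close>

lemma prod_add_const_expand:
  "\<exists>H. (\<Prod>c\<in>S. g + [:e c:]) = g * H + [:\<Prod>c\<in>S. e c:]" for g :: "int poly"
proof (induction S rule: infinite_finite_induct)
  case (insert x S)
  then obtain H where "(\<Prod>c\<in>S. g + [:e c:]) = g * H + [:\<Prod>c\<in>S. e c:]" by blast
  then have "(\<Prod>c\<in>insert x S. g + [:e c:]) = (g + [:e x:]) * (g * H + [:\<Prod>c\<in>S. e c:])"
    using insert by simp
  also have "\<dots> = g * (g * H + [:\<Prod>c\<in>S. e c:] + [:e x:] * H) + [:\<Prod>c\<in>insert x S. e c:]"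
    using insert by (simp add: algebra_simps)
  finally show ?case by blast
qed (auto intro: exI[of _ 0] simp: one_pCons)

definition shifted_powers :: "nat \<Rightarrow> int set \<Rightarrow> int poly" where
  "shifted_powers d S = (\<Prod>c\<in>S. monom 1 d + [:c:])"

lemma monic_binomial: 
  assumes "d > 0" shows "degree (monom 1 d + [:c:]) = d" "lead_coeff (monom 1 d + [:c:]) = (1::int)"
proof -
  have "degree [:c:] < degree (monom (1::int) d)" using assms by (simp add: degree_monom_eq)
  then show 1: "degree (monom 1 d + [:c:]) = d" by (simp add: degree_add_eq_left degree_monom_eq)
  show "lead_coeff (monom 1 d + [:c:]) = 1" unfolding 1 using assms by (simp add: coeff_pCons split: nat.split)
qed

lemma binomial_neq_0: "d > 0 \<Longrightarrow> monom 1 d + [:c:] \<noteq> (0 :: int poly)"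
  using monic_binomial(1)[of d c] by (metis degree_0 less_irrefl)

lemma degree_shifted_powers: 
  assumes "d > 0" shows "degree (shifted_powers d S) = d * card S"
proof -
  have "degree (shifted_powers d S) = (\<Sum>c\<in>S. degree (monom 1 d + [:c:]))"
    unfolding shifted_powers_def using binomial_neq_0[OF assms] by (intro degree_prod_eq_sum_degree) simp
  then show ?thesis using assms by (simp only: monic_binomial(1) sum_constant) (simp add: mult.commute)
qed

lemma lead_coeff_shifted_powers: 
  assumes "d > 0" shows "lead_coeff (shifted_powers d S) = 1"
proof -
  have "lead_coeff (shifted_powers d S) = (\<Prod>c\<in>S. lead_coeff (monom 1 d + [:c:]))"
    unfolding shifted_powers_def by (rule lead_coeff_prod)
  then show ?thesis by (simp only: monic_binomial(2)[OF assms] prod.neutral_const)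
qed

text \<open>Infinite descent on one factor g = z^d + c. It may be reducible, but modulo g there are
  no nilpotents and the product k of the other factors is a unit. From g k A^2 = \<kappa> B^2 with
  \<kappa> nonzero one gets g | B, then g | A, and the same equation for the quotients, so every
  power of g divides A.\<close>

lemma never_square_shifted_powers:
  assumes d: "d > 0" "d dvd p - 1" and S: "finite S" "S \<noteq> {}" "S \<subseteq> {1..<int p}"
  shows "never_square (shifted_powers d S)"
  unfolding never_square_def
proof (intro allI impI)
  fix A B \<kappa> assume AB: "shifted_powers d S * A\<^sup>2 \<doteq> [:\<kappa>:] * B\<^sup>2"
  obtain c where c: "c \<in> S" using S(2) by blast
  define g where "g = monom 1 d + [:c:]"
  define k where "k = (\<Prod>c\<in>S - {c}. monom 1 d + [:c:])"
  have f: "shifted_powers d S = g * k"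
    unfolding shifted_powers_def g_def k_def using c S(1) by (simp add: prod.remove)
  have g: "lead_coeff g = 1" "degree g = d" unfolding g_def using monic_binomial[OF d(1)] by auto
  have g0: "\<not> g \<doteq> 0" by (rule monic_not_cg_0[OF g(1)])
  have not0: "\<not> a \<doteq> 0" if "a \<noteq> 0" "\<bar>a\<bar> < int p" for a :: int
    using that zdvd_imp_le[of "int p" "\<bar>a\<bar>"] by (auto simp: cg_0_iff)
  have c0: "\<not> c \<doteq> 0" using c S(3) by (intro not0) auto
  have reduced: "\<exists>H. X \<doteq> g * H" if "X\<^sup>2 \<doteq> g * H" for X H
    using binomial_dvd_square[OF d c0] that unfolding g_def by blast
  have "k = (\<Prod>x\<in>S - {c}. g + [:x - c:])" unfolding k_def g_def by (intro prod.cong) auto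
  with prod_add_const_expand obtain K where K: "k = g * K + [:\<Prod>x\<in>S - {c}. x - c:]" by metis
  have "\<not> (\<Prod>x\<in>S - {c}. x - c) \<doteq> 0"
  proof
    assume "(\<Prod>x\<in>S - {c}. x - c) \<doteq> 0"
    then obtain x where x: "x \<in> S" "x \<noteq> c" "x - c \<doteq> 0"
      unfolding cg_0_iff using prime_p S(1) prime_dvd_prod_iff[of "S - {c}" "int p" "\<lambda>x. x - c"] by auto
    have "x \<in> {1..<int p}" "c \<in> {1..<int p}" using S(3) x c by auto
    then have "\<bar>x - c\<bar> < int p" by auto
    then show False using x not0[of "x - c"] by auto
  qed
  then obtain l where l: "(\<Prod>x\<in>S - {c}. x - c) * l \<doteq> 1" using inverse_cg by blast
  show "A \<doteq> 0"
  proof (cases "\<kappa> \<doteq> 0")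
    case True
    then have "[:\<kappa>:] * B\<^sup>2 \<doteq> 0" using cg_const[of \<kappa> 0] by (intro cg_mult_0) simp
    with AB have "shifted_powers d S * A\<^sup>2 \<doteq> 0" by (rule cg_trans)
    then show ?thesis using cg_mult_0_poly monic_not_cg_0[OF lead_coeff_shifted_powers[OF d(1)]]
      by (metis power2_eq_square)
  next
    case False
    then obtain \<kappa>' where \<kappa>': "\<kappa> * \<kappa>' \<doteq> 1" using inverse_cg by blast
    have step: "\<exists>A' B'. A \<doteq> g * A' \<and> g * k * A'\<^sup>2 \<doteq> [:\<kappa>:] * B'\<^sup>2"
      if AB: "g * k * A\<^sup>2 \<doteq> [:\<kappa>:] * B\<^sup>2" for A B
    proof -
      have "1 * B\<^sup>2 \<doteq> [:\<kappa> * \<kappa>':] * B\<^sup>2" using cg_const[OF cg_sym[OF \<kappa>']]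
        by (intro cg_mult cg_refl) (simp add: one_pCons)
      also have "\<dots> = [:\<kappa>':] * ([:\<kappa>:] * B\<^sup>2)" by (simp add: mult_ac)
      also have "\<dots> \<doteq> [:\<kappa>':] * (g * k * A\<^sup>2)" by (intro cg_mult cg_refl cg_sym[OF AB])
      also have "\<dots> = g * ([:\<kappa>':] * k * A\<^sup>2)" by (simp add: mult_ac)
      finally have "B\<^sup>2 \<doteq> g * ([:\<kappa>':] * k * A\<^sup>2)" unfolding mult_1 .
      from reduced[OF this] obtain B1 where B1: "B \<doteq> g * B1" by blast
      have "g * (k * A\<^sup>2) \<doteq> [:\<kappa>:] * B\<^sup>2" using AB by (simp add: mult_ac)
      also have "\<dots> \<doteq> [:\<kappa>:] * (g * B1)\<^sup>2" by (intro cg_mult cg_refl cg_power B1)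
      also have "\<dots> = g * ([:\<kappa>:] * g * B1\<^sup>2)" by (simp add: power2_eq_square mult_ac)
      finally have kA: "k * A\<^sup>2 \<doteq> [:\<kappa>:] * g * B1\<^sup>2" by (rule cg_cancel_poly[OF _ g0])
      have "1 * A\<^sup>2 \<doteq> [:(\<Prod>x\<in>S - {c}. x - c) * l:] * A\<^sup>2" using cg_const[OF cg_sym[OF l]]
        by (intro cg_mult cg_refl) (simp add: one_pCons)
      also have "\<dots> = [:l:] * (k * A\<^sup>2) - g * ([:l:] * K * A\<^sup>2)"
        unfolding K by (simp add: algebra_simps)
      also have "\<dots> \<doteq> [:l:] * ([:\<kappa>:] * g * B1\<^sup>2) - g * ([:l:] * K * A\<^sup>2)"
        by (intro cg_diff cg_mult cg_refl kA)
      also have "\<dots> = g * ([:l:] * [:\<kappa>:] * B1\<^sup>2 - [:l:] * K * A\<^sup>2)" by (simp add: algebra_simps)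
      finally have "A\<^sup>2 \<doteq> g * ([:l:] * [:\<kappa>:] * B1\<^sup>2 - [:l:] * K * A\<^sup>2)" unfolding mult_1 .
      from reduced[OF this] obtain A1 where A1: "A \<doteq> g * A1" by blast
      have "g * (g * k * A1\<^sup>2) = k * (g * A1)\<^sup>2" by (simp add: power2_eq_square mult_ac)
      also have "\<dots> \<doteq> k * A\<^sup>2" by (intro cg_mult cg_refl cg_power cg_sym[OF A1])
      also note kA
      also have "[:\<kappa>:] * g * B1\<^sup>2 = g * ([:\<kappa>:] * B1\<^sup>2)" by (simp add: mult_ac)
      finally have "g * k * A1\<^sup>2 \<doteq> [:\<kappa>:] * B1\<^sup>2" by (rule cg_cancel_poly[OF _ g0])
      with A1 show ?thesis by blast
    qed
    have "\<exists>A' B'. A \<doteq> g ^ j * A' \<and> g * k * A'\<^sup>2 \<doteq> [:\<kappa>:] * B'\<^sup>2" for j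
    proof (induction j)
      case 0
      then show ?case using AB unfolding f by (intro exI[of _ A] exI[of _ B]) simp
    next
      case (Suc j)
      then obtain A1 B1 where 1: "A \<doteq> g ^ j * A1" "g * k * A1\<^sup>2 \<doteq> [:\<kappa>:] * B1\<^sup>2" by blast
      from step[OF 1(2)] obtain A2 B2 where 2: "A1 \<doteq> g * A2" "g * k * A2\<^sup>2 \<doteq> [:\<kappa>:] * B2\<^sup>2" by blast
      have "A \<doteq> g ^ j * (g * A2)" using 1(1) cg_mult[OF cg_refl 2(1)] by (rule cg_trans)
      with 2(2) show ?case by (intro exI[of _ A2] exI[of _ B2]) (simp add: mult_ac)
    qed
    then obtain A' where A': "A \<doteq> g ^ Suc (degree A) * A'" by blast
    show "A \<doteq> 0"
    proof (rule monic_dvd_cg_0[OF A'])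
      show "lead_coeff (g ^ Suc (degree A)) = 1" using g(1) by (simp only: lead_coeff_power power_one)
      have "g \<noteq> 0" using g(1) by auto
      then have "degree (g ^ Suc (degree A)) = Suc (degree A) * d" using g(2)
        by (simp add: degree_power_eq del: power_Suc mult_Suc)
      then show "degree A < degree (g ^ Suc (degree A))" 
        using mult_le_mono2[of 1 d "Suc (degree A)"] d(1) by simp
    qed
  qed
qed

lemma Legendre_eq_iff:
  assumes p: "p = 2 * r + 1" and \<epsilon>: "\<epsilon> = 1 \<or> \<epsilon> = -1"
  shows "Legendre a (int p) = \<epsilon> \<longleftrightarrow> a ^ r \<doteq> \<epsilon>"
proof -
  have "p > 2" using p prime_gt_1_nat[OF prime_p] by presburger
  then have "Legendre a (int p) \<doteq> a ^ r"
    using euler_criterion[OF prime_p, of a] p unfolding cg_int_iff by simp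
  moreover have "Legendre a (int p) \<doteq> \<epsilon> \<Longrightarrow> Legendre a (int p) = \<epsilon>"
    using \<epsilon> \<open>p > 2\<close> zdvd_imp_le[of "int p" 2] zdvd_imp_le[of "int p" 1]
    by (auto simp: Legendre_def cg_def dvd_diff_commute)
  ultimately show ?thesis by (metis cg_sym cg_trans)
qed

text \<open>The sum is the difference of the counts of the values 1 and -1. Upper bounds for both
  counts suffice: they add up to p minus the number of zeros, and there are at most deg f
  zeros.\<close>

lemma Legendre_sum_bound:
  assumes p: "p = 2 * r + 1" and f: "never_square f" "degree f \<le> 2 * m" "m > 0" "\<not> f \<doteq> 0"
    and h: "h > 0" and r: "m + h + 2 * h\<^sup>2 \<le> r + 1"
  shows "\<bar>real_of_int (\<Sum>t\<in>{0..<int p}. Legendre (poly f t) (int p))\<bar>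
    \<le> (2 * real m - 1) * real p / (2 * real h) + real (degree f)"
proof -
  define T where "T \<epsilon> = {t \<in> {0..<int p}. poly f t ^ r \<doteq> \<epsilon>}" for \<epsilon> :: int
  define Z where "Z = {t \<in> {0..<int p}. Legendre (poly f t) (int p) = 0}"
  have fin: "finite (T \<epsilon>)" "finite Z" for \<epsilon>
    by (rule finite_subset[of _ "{0..<int p}"], auto simp: T_def Z_def)+
  have T: "T \<epsilon> = {t \<in> {0..<int p}. Legendre (poly f t) (int p) = \<epsilon>}" if "\<epsilon> = 1 \<or> \<epsilon> = -1" for \<epsilon>
    using Legendre_eq_iff[OF p that] by (auto simp: T_def)
  have U: "{0..<int p} = T 1 \<union> T (-1) \<union> Z"
    unfolding T[OF disjI1[OF refl]] T[OF disjI2[OF refl]] Z_def by (auto simp: Legendre_def)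
  have disj: "T 1 \<inter> T (-1) = {}" "(T 1 \<union> T (-1)) \<inter> Z = {}"
    unfolding T[OF disjI1[OF refl]] T[OF disjI2[OF refl]] Z_def by auto
  have s: "(\<Sum>t\<in>{0..<int p}. Legendre (poly f t) (int p)) = int (card (T 1)) - int (card (T (-1)))"
  proof -
    have "(\<Sum>t\<in>T 1. Legendre (poly f t) (int p)) = int (card (T 1))"
      "(\<Sum>t\<in>T (-1). Legendre (poly f t) (int p)) = - int (card (T (-1)))"
      "(\<Sum>t\<in>Z. Legendre (poly f t) (int p)) = 0"
      by (simp_all add: T Z_def)
    then show ?thesis unfolding U using fin disj by (simp add: sum.union_disjoint)
  qed
  have "card {0..<int p} = card (T 1) + card (T (-1)) + card Z"
    unfolding U using fin disj by (simp add: card_Un_disjoint)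
  then have c: "p = card (T 1) + card (T (-1)) + card Z" by simp
  have "1 * card Z \<le> degree f"
  proof (rule count_roots[OF _ _ _ f(4)])
    fix a assume "a \<in> Z"
    then have "poly f a \<doteq> 0" by (auto simp: Z_def Legendre_def cg_int_iff split: if_splits)
    then show "\<exists>h. f \<doteq> [:- a, 1:] ^ 1 * h" using linear_factor by simp
  qed (use fin in \<open>auto simp: Z_def\<close>)
  then have Z: "real (card Z) \<le> real (degree f)" by simp
  have bound: "2 * real (card (T \<epsilon>)) \<le> real p + (2 * real m - 1) * real p / (2 * real h)" if "\<epsilon> * \<epsilon> = 1" for \<epsilon>
  proof -
    have "2 * h * card (T \<epsilon>) \<le> p * (m + h - 1) + r - m"
      unfolding T_def by (rule stepanov_bound[OF p f(1-3) h r that])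
    also have "\<dots> \<le> p * (m + h - 1) + r" by simp
    finally have "real (2 * h * card (T \<epsilon>)) \<le> real (p * (m + h - 1) + r)" by (rule of_nat_mono)
    also have "\<dots> = real p * (real m + real h - 1) + (real p - 1) / 2"
    proof -
      have "real (m + h - 1) = real m + real h - 1" using h by (simp add: of_nat_diff)
      moreover have "real r = (real p - 1) / 2" unfolding p by simp
      ultimately show ?thesis by (simp only: of_nat_add of_nat_mult)
    qed
    also have "\<dots> \<le> real p * (real m + real h - 1) + real p / 2" by simp
    \<comment> \<open>The m - 1 multiples of p and the half multiple from r combine to the factor (2
      m - 1) / 2.\<close>
    also have "\<dots> = real h * (real p + (2 * real m - 1) * real p / (2 * real h))"
      using h by (simp add: field_simps)
    finally have "real h * (2 * real (card (T \<epsilon>))) \<le> real h * (real p + (2 * real m - 1) * real p / (2 * real h))"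
      by (simp add: mult_ac)
    then show ?thesis using h by simp
  qed
  show ?thesis unfolding s using bound[of 1] bound[of "-1"] Z c by (simp add: abs_le_iff)
qed

end

section \<open>Sieving the primitive elements\<close>

lemma prod_primes_dvd_iff:
  assumes "finite Q" "\<forall>q\<in>Q. prime (q::nat)"
  shows "\<Prod>Q dvd j \<longleftrightarrow> (\<forall>q\<in>Q. q dvd j)"
  using assms
proof (induction Q rule: finite_induct)
  case (insert q Q)
  have "coprime q (\<Prod>Q)"
    using insert.prems insert.hyps by (intro prod_coprime_right primes_coprime) auto
  then have "q * \<Prod>Q dvd j \<longleftrightarrow> q dvd j \<and> \<Prod>Q dvd j"
    by (metis divides_mult dvd_mult_left dvd_mult_right)
  with insert show ?case by simp
qed simp

lemma prime_factors_prod_primes: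
  assumes "finite Q" "\<forall>q\<in>Q. prime (q::nat)"
  shows "prime_factors (\<Prod>Q) = Q"
proof -
  have "0 \<notin> Q" using assms(2) by (metis not_prime_0)
  then have "prime_factors (\<Prod>Q) = \<Union> (prime_factors ` Q)"
    using prime_factors_prod[OF assms(1), of "\<lambda>x. x"] by simp
  also have "\<dots> = Q" using assms(2) by (auto simp: prime_prime_factors)
  finally show ?thesis .
qed

text \<open>The sieve indexes squarefree divisors by sets Q of primes, with divisor the product of
  Q; this compares their number with W.\<close>

lemma card_Pow_prime_factors_le_W:
  assumes "n > 0"
  shows "card (Pow (prime_factors n)) \<le> W n"
  unfolding W_def
proof (rule card_inj_on_le[where f = "\<lambda>Q. \<Prod>Q"])
  have fin: "finite Q" "\<forall>q\<in>Q. prime q" if "Q \<in> Pow (prime_factors n)" for Q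
    using that finite_subset[of Q "prime_factors n"] by auto
  show "inj_on (\<lambda>Q. \<Prod>Q) (Pow (prime_factors n))"
    by (rule inj_onI) (metis fin prime_factors_prod_primes)
  show "(\<lambda>Q. \<Prod>Q) ` Pow (prime_factors n) \<subseteq> {d. 0 < d \<and> d dvd n \<and> squarefree d}"
  proof
    fix d assume "d \<in> (\<lambda>Q. \<Prod>Q) ` Pow (prime_factors n)"
    then obtain Q where Q: "Q \<in> Pow (prime_factors n)" "d = \<Prod>Q" by blast
      have "d dvd n" unfolding Q(2) prod_primes_dvd_iff[OF fin[OF Q(1)]] using Q(1) by (auto simp: in_prime_factors_iff)
    moreover have "squarefree d" unfolding Q(2)
      using fin[OF Q(1)] by (intro squarefree_prod_coprime) (auto intro: primes_coprime squarefree_prime)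
    ultimately show "d \<in> {d. 0 < d \<and> d dvd n \<and> squarefree d}" using assms by (auto intro: Nat.gr0I)
  qed
  show "finite {d. 0 < d \<and> d dvd n \<and> squarefree d}"
    using assms by (intro finite_subset[OF _ finite_divisors_nat[of n]]) auto
qed

text \<open>Expand the product of 1 - [q | j] over the primes q dividing n; (-1)^|Q| plays the part
  of the Moebius function.\<close>

lemma coprime_indicator:
  fixes n j :: nat
  assumes "n > 0"
  shows "(\<Sum>Q\<in>Pow (prime_factors n). (-1) ^ card Q * (if \<Prod>Q dvd j then 1 else 0))
    = (if coprime j n then 1 else (0 :: int))"
proof -
  have "(\<Sum>Q\<in>Pow (prime_factors n). (-1) ^ card Q * (if \<Prod>Q dvd j then 1 else (0::int)))
      = (\<Sum>Q\<in>Pow (prime_factors n). (\<Prod>q\<in>Q. if q dvd j then -1 else 0) * (\<Prod>q\<in>prime_factors n - Q. 1))"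
  proof (intro sum.cong refl)
    fix Q assume Q: "Q \<in> Pow (prime_factors n)"
    have fin: "finite Q" "\<forall>q\<in>Q. prime q"
      using Q finite_subset[of Q "prime_factors n"] by auto
    show "(-1) ^ card Q * (if \<Prod>Q dvd j then 1 else (0::int))
        = (\<Prod>q\<in>Q. if q dvd j then -1 else 0) * (\<Prod>q\<in>prime_factors n - Q. 1)"
    proof (cases "\<forall>q\<in>Q. q dvd j")
      case True
      then show ?thesis using prod_primes_dvd_iff[OF fin] by simp
    next
      case False
      then have "(\<Prod>q\<in>Q. if q dvd j then -1 else (0::int)) = 0" using fin(1) by (auto simp: prod_zero_iff)
      with False show ?thesis using prod_primes_dvd_iff[OF fin] by simp
    qed
  qed
  also have "\<dots> = (\<Prod>q\<in>prime_factors n. (if q dvd j then -1 else 0) + 1)"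
    by (rule prod_add[symmetric]) simp
  also have "\<dots> = (if coprime j n then 1 else 0)"
  proof (cases "coprime j n")
    case True
    have "\<not> q dvd j" if "q \<in> prime_factors n" for q
      using True that by (metis coprime_common_divisor in_prime_factors_iff not_prime_unit)
    with True show ?thesis by simp
  next
    case False
    then obtain q where "prime q" "q dvd j" "q dvd n" by (metis coprime_iff_gcd_eq_1 gcd_nat.bounded_iff prime_factor_nat)
    then have "q \<in> prime_factors n" "q dvd j" using assms by (auto simp: in_prime_factors_iff)
    then have "(\<Prod>q\<in>prime_factors n. (if q dvd j then -1 else 0) + (1::int)) = 0"
      by (intro prod_zero) auto
    with False show ?thesis by simp
  qed
  finally show ?thesis .
qed

lemma totatives_eq_lessThan: "n > 1 \<Longrightarrow> totatives n = {j \<in> {..<n}. coprime j n}"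
  by (auto simp: totatives_def intro: Nat.gr0I) (metis coprime_self le_neq_implies_less less_irrefl nat_dvd_1_iff_1 One_nat_def)

text \<open>Residues coprime to an even n are odd, and their predecessors form a disjoint set of the
  same size below n.\<close>

lemma totient_even_le:
  assumes "even n" "n > 0"
  shows "2 * totient n \<le> n"
proof -
  let ?T = "{j \<in> {..<n}. coprime j n}"
  have n1: "n > 1" using assms by presburger
  have odd: "odd j" if "j \<in> ?T" for j using that assms(1) coprime_common_divisor_nat[of j n 2] by auto
  have "inj_on (\<lambda>j. j - 1) ?T"
  proof (rule inj_onI)
    fix x y assume "x \<in> ?T" "y \<in> ?T" "x - 1 = y - 1"
    then show "x = y" using odd_pos[OF odd[of x]] odd_pos[OF odd[of y]] by linarith
  qed
  then have "card ((\<lambda>j. j - 1) ` ?T) = totient n"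
    unfolding totient_def totatives_eq_lessThan[OF n1] by (rule card_image)
  moreover have "card (?T \<union> (\<lambda>j. j - 1) ` ?T) = card ?T + card ((\<lambda>j. j - 1) ` ?T)"
  proof (intro card_Un_disjoint)
    have False if "y \<in> ?T" "y - 1 \<in> ?T" for y
      using odd[OF that(1)] odd[OF that(2)] by (cases y) auto
    then show "?T \<inter> (\<lambda>j. j - 1) ` ?T = {}" by blast
  qed auto
  moreover have "card (?T \<union> (\<lambda>j. j - 1) ` ?T) \<le> card {..<n}" by (intro card_mono) auto
  ultimately show ?thesis by (simp add: totient_def totatives_eq_lessThan[OF n1])
qed

lemma sum_card_Pow: "finite C \<Longrightarrow> (\<Sum>S\<in>Pow C. card S) = card C * 2 ^ (card C - 1)"
proof (induction C rule: finite_induct)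
  case (insert x C)
  have "(\<Sum>S\<in>Pow (insert x C). card S) = (\<Sum>S\<in>Pow C. card S) + (\<Sum>S\<in>insert x ` Pow C. card S)"
    unfolding Pow_insert using insert.hyps by (intro sum.union_disjoint) auto
  also have "(\<Sum>S\<in>insert x ` Pow C. card S) = (\<Sum>S\<in>Pow C. card (insert x S))"
    using insert.hyps by (subst sum.reindex) (auto simp: inj_on_def)
  also have "\<dots> = (\<Sum>S\<in>Pow C. card S + 1)"
  proof (intro sum.cong refl)
    fix S assume "S \<in> Pow C"
    then have "finite S" "x \<notin> S" using insert.hyps finite_subset by auto
    then show "card (insert x S) = card S + 1" by simp
  qed
  also have "\<dots> = (\<Sum>S\<in>Pow C. card S) + 2 ^ card C"
    using insert.hyps by (subst sum.distrib) (simp add: card_Pow)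
  finally show ?case using insert by (cases "card C") (simp_all add: algebra_simps)
qed simp

text \<open>Multiplication by d runs d times through the multiples of d modulo n. For exponents of a
  primitive root this turns a sum over d | j into a sum over d-th powers of all nonzero
  residues.\<close>

lemma sum_periodic_multiples:
  fixes F :: "nat \<Rightarrow> int"
  assumes n: "n > 0" "d dvd n" and F: "\<And>j. F (j + n) = F j"
  shows "int d * (\<Sum>j | j < n \<and> d dvd j. F j) = (\<Sum>j<n. F (d * j))"
proof -
  obtain e where e: "n = d * e" using n(2) by blast
  have d: "d > 0" using n(1) e by (cases d) auto
  have F': "F (j + n * i) = F j" for i j
    by (induction i) (simp_all add: F add.assoc[symmetric] add.commute[of n])
  have "(\<Sum>j<n. F (d * j)) = (\<Sum>i<d. \<Sum>j = i * e..<i * e + e. F (d * j))"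
    unfolding e by (rule sum.nat_group[symmetric])
  also have "\<dots> = (\<Sum>i<d. \<Sum>k<e. F (d * k))"
  proof (rule sum.cong[OF refl])
    fix i
    have "(\<Sum>j = i * e..<i * e + e. F (d * j)) = (\<Sum>k = 0..<e. F (d * (k + i * e)))"
      using sum.shift_bounds_nat_ivl[of "\<lambda>j. F (d * j)" 0 "i * e" e] by (simp add: add.commute)
    also have "\<dots> = (\<Sum>k<e. F (d * k))"
      using F'[of "d * _" i] e by (simp add: algebra_simps atLeast0LessThan)
    finally show "(\<Sum>j = i * e..<i * e + e. F (d * j)) = (\<Sum>k<e. F (d * k))" .
  qed
  also have "\<dots> = int d * (\<Sum>k<e. F (d * k))" by simp
  also have "(\<Sum>k<e. F (d * k)) = (\<Sum>j | j < n \<and> d dvd j. F j)"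
    using d unfolding e by (intro sum.reindex_bij_witness[where i = "\<lambda>j. j div d" and j = "\<lambda>k. d * k"])
      (auto simp: less_mult_imp_div_less mult.commute)
  finally show ?thesis by simp
qed

context prime_modulus
begin

section \<open>The Legendre symbol and primitive roots\<close>

lemma Legendre_values: "Legendre a q \<in> {-1, 0, 1}"
  by (simp add: Legendre_def)

lemma Legendre_cg: "a \<doteq> b \<Longrightarrow> Legendre a (int p) = Legendre b (int p)"
proof -
  assume "a \<doteq> b"
  then have ab: "[a = b] (mod int p)" by (simp only: cg_int_iff)
  then have "[a = 0] (mod int p) \<longleftrightarrow> [b = 0] (mod int p)" using cong_sym cong_trans by blast
  moreover have "QuadRes (int p) a \<longleftrightarrow> QuadRes (int p) b"
    unfolding QuadRes_def using ab cong_sym cong_trans by blast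
  ultimately show ?thesis by (simp only: Legendre_def)
qed

lemma Legendre_mult:
  assumes "p > 2"
  shows "Legendre (a * b) (int p) = Legendre a (int p) * Legendre b (int p)"
proof -
  define r where "r = (p - 1) div 2"
  have L: "Legendre x (int p) \<doteq> x ^ r" for x
    using euler_criterion[OF prime_p assms, of x] unfolding cg_int_iff r_def by simp
  have "Legendre (a * b) (int p) \<doteq> (a * b) ^ r" by (rule L)
  also have "\<dots> \<doteq> Legendre a (int p) * Legendre b (int p)"
    unfolding power_mult_distrib by (intro cg_mult cg_sym[OF L])
  finally have "int p dvd Legendre (a * b) (int p) - Legendre a (int p) * Legendre b (int p)"
    by (simp add: cg_def)
  moreover have "\<bar>Legendre (a * b) (int p) - Legendre a (int p) * Legendre b (int p)\<bar> \<le> 2"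
    using Legendre_values[of "a * b" "int p"] Legendre_values[of a "int p"] Legendre_values[of b "int p"] by auto
  ultimately show ?thesis using assms zdvd_imp_le[of "int p" "\<bar>Legendre (a * b) (int p) - Legendre a (int p) * Legendre b (int p)\<bar>"]
    by auto
qed

lemma Legendre_prod:
  assumes "p > 2"
  shows "Legendre (\<Prod>x\<in>S. g x) (int p) = (\<Prod>x\<in>S. Legendre (g x) (int p))"
proof (induction S rule: infinite_finite_induct)
  case (insert x S)
  then show ?case by (simp add: Legendre_mult[OF assms])
next
  case empty
  have "\<not> [1 = 0] (mod int p)" using assms by (simp add: cong_0_iff)
  moreover have "QuadRes (int p) 1" unfolding QuadRes_def by (intro exI[of _ 1]) simp
  ultimately show ?case by (simp add: Legendre_def)
next
  case (infinite S)
  have "\<not> [1 = 0] (mod int p)" using assms by (simp add: cong_0_iff)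
  moreover have "QuadRes (int p) 1" unfolding QuadRes_def by (intro exI[of _ 1]) simp
  ultimately show ?case using infinite by (simp add: Legendre_def)
qed

lemma primroot_power_bij:
  assumes "residue_primroot p g"
  shows "bij_betw (\<lambda>j. int g ^ j mod int p) {..<p - 1} {1..<int p}"
proof -
  have "bij_betw (\<lambda>j. g ^ j mod p) {..<p - 1} {0<..<p}"
    using residue_primroot_is_generator[OF prime_gt_1_nat[OF prime_p] assms] prime_p
    by (simp add: totient_prime totatives_prime)
  moreover have "bij_betw int {0<..<p} {1..<int p}"
    by (intro bij_betwI[where g = nat]) auto
  ultimately have "bij_betw (int \<circ> (\<lambda>j. g ^ j mod p)) {..<p - 1} {1..<int p}"
    by (rule bij_betw_trans)
  then show ?thesis by (simp add: comp_def zmod_int)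
qed

lemma primroot_power:
  assumes g: "residue_primroot p g" and j: "coprime j (p - 1)"
  shows "g ^ j mod p \<in> prim_elems p"
proof -
  have "ord p (g ^ j) * gcd j (ord p g) = ord p g" by (rule ord_power_aux)
  then have "residue_primroot p (g ^ j)"
    using g j prime_p by (simp add: residue_primroot_def totient_prime)
  then show ?thesis using prime_gt_0_nat[OF prime_p] by (simp add: prim_elems_def)
qed

text \<open>By Euler's criterion, the value 1 would make the order p - 1 divide (p - 1) / 2.\<close>

lemma Legendre_primroot:
  assumes g: "residue_primroot p g" and p: "p > 2"
  shows "Legendre (int g) (int p) = -1"
proof -
  have o: "ord p g = p - 1" and c: "coprime p g" using g prime_p by (simp_all add: residue_primroot_def totient_prime)
  have odd: "odd p" using prime_p p by (simp add: prime_odd_nat)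
  have "\<not> p dvd g"
  proof
    assume "p dvd g"
    then have "p dvd 1" using c coprime_absorb_left by blast
    with p show False by simp
  qed
  then have "\<not> [int g = 0] (mod int p)" by (simp add: cong_0_iff)
  moreover have "Legendre (int g) (int p) \<noteq> 1"
  proof
    assume 1: "Legendre (int g) (int p) = 1"
    have "[Legendre (int g) (int p) = int g ^ ((p - 1) div 2)] (mod int p)"
      by (rule euler_criterion[OF prime_p p])
    then have "[int (g ^ ((p - 1) div 2)) = int 1] (mod int p)" using 1 cong_sym by simp
    then have "[g ^ ((p - 1) div 2) = 1] (mod p)" by (simp only: cong_int_iff)
    then have "p - 1 dvd (p - 1) div 2" unfolding ord_divides o .
    then have "p - 1 \<le> (p - 1) div 2" using p by (intro dvd_imp_le) auto
    then show False using p by linarith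
  qed
  ultimately show ?thesis by (auto simp: Legendre_def split: if_splits)
qed

lemma sum_Legendre: 
  assumes "p > 2" shows "(\<Sum>t\<in>{1..<int p}. Legendre t (int p)) = 0"
proof -
  obtain g where g: "residue_primroot p g"
    using prime_primitive_root_exists[of p] prime_p prime_gt_1_nat[OF prime_p] by auto
  have "(\<Sum>t\<in>{1..<int p}. Legendre t (int p)) = (\<Sum>j<p - 1. Legendre (int g ^ j mod int p) (int p))"
    by (rule sum.reindex_bij_betw[OF primroot_power_bij[OF g], symmetric])
  also have "\<dots> = (\<Sum>j<p - 1. (-1) ^ j)"
  proof (intro sum.cong refl)
    fix j
    have "Legendre (int g ^ j mod int p) (int p) = Legendre (\<Prod>i<j. int g) (int p)"
      by (rule Legendre_cg) (simp add: cg_int_iff)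
    then show "Legendre (int g ^ j mod int p) (int p) = (-1) ^ j"
      unfolding Legendre_prod[OF assms] Legendre_primroot[OF g assms] by simp
  qed
  also have "\<dots> = 0"
  proof -
    have *: "(\<Sum>j<2 * m. (-1) ^ j) = (0::int)" for m by (induction m) auto
    obtain m where "p - 1 = 2 * m" using prime_odd_nat[OF prime_p assms] by (auto elim!: oddE)
    then show ?thesis using * by simp
  qed
  finally show ?thesis .
qed

lemma sum_Legendre_shift: 
  assumes "p > 2" shows "(\<Sum>t\<in>{0..<int p}. Legendre (t + c) (int p)) = 0"
proof -
  have p0: "int p > 0" using assms by simp
  have bij: "bij_betw (\<lambda>t. (t + c) mod int p) {0..<int p} {0..<int p}"
  proof (rule bij_betwI[where g = "\<lambda>t. (t - c) mod int p"])
    show "((t + c) mod int p - c) mod int p = t" if "t \<in> {0..<int p}" for t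
      using that by (simp add: mod_diff_left_eq)
    show "((t - c) mod int p + c) mod int p = t" if "t \<in> {0..<int p}" for t
      using that by (simp add: mod_add_left_eq)
  qed (use p0 in auto)
  have "(\<Sum>t\<in>{0..<int p}. Legendre (t + c) (int p)) = (\<Sum>t\<in>{0..<int p}. Legendre ((t + c) mod int p) (int p))"
    by (intro sum.cong refl Legendre_cg) (simp add: cg_int_iff)
  also have "\<dots> = (\<Sum>t\<in>{0..<int p}. Legendre t (int p))"
    by (rule sum.reindex_bij_betw[OF bij])
  also have "\<dots> = (\<Sum>t\<in>insert 0 {1..<int p}. Legendre t (int p))" using p0 by (intro sum.cong) auto
  also have "\<dots> = 0"
    using sum_Legendre[OF assms] by (simp add: Legendre_def)
  finally show ?thesis .
qed

section \<open>Complete sums over products of shifted powers\<close>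

lemma poly_shifted_powers: "poly (shifted_powers d S) t = (\<Prod>c\<in>S. t ^ d + c)"
  by (simp add: shifted_powers_def poly_prod poly_monom)

lemma shifted_powers_sum_bound_small:
  assumes s: "sqrt (real p) > 16" and d: "d > 0" "d dvd p - 1"
    and S: "finite S" "S \<noteq> {}" "S \<subseteq> {1..<int p}"
    and m: "d * card S \<le> 2 * m" "2 * real m \<le> sqrt (real p) + 1"
  shows "\<bar>real_of_int (\<Sum>t\<in>{0..<int p}. Legendre (\<Prod>c\<in>S. t ^ d + c) (int p))\<bar>
    \<le> (2 * real m - 1) * (sqrt (real p) + 3.7) + real (d * card S)"
proof -
  define s where "s = sqrt (real p)"
  \<comment> \<open>Fitted to the condition of \<open>Legendre_sum_bound\<close>: with 2 m <= s + 1
    and 2 h <= s - 1, the sum 2 m + 2 h + (2 h)^2 is at most s^2 + 1 = 2 r + 2.\<close>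
  define h where "h = nat \<lfloor>(s - 1) / 2\<rfloor>"
  have s16: "s > 16" using s by (simp add: s_def)
  have ps: "real p = s * s" by (simp add: s_def)
  have "p \<noteq> 2" using s16 real_sqrt_less_mono[of 2 256] by (auto simp: s_def)
  then obtain r where r: "p = 2 * r + 1" using prime_odd_nat[OF prime_p] prime_ge_2_nat[OF prime_p] by (metis le_neq_implies_less oddE)
  have m0: "m > 0" using d(1) S m(1) by (auto intro: Nat.gr0I simp: card_gt_0_iff)
  have "real h = real_of_int \<lfloor>(s - 1) / 2\<rfloor>" using s16 by (simp add: h_def)
  moreover have "real_of_int \<lfloor>(s - 1) / 2\<rfloor> \<le> (s - 1) / 2" by (rule of_int_floor_le)
  moreover have "(s - 1) / 2 < real_of_int \<lfloor>(s - 1) / 2\<rfloor> + 1" by simp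
  ultimately have "real h \<le> (s - 1) / 2" "(s - 1) / 2 < real h + 1" by (simp_all only:)
  then have h: "2 * real h \<le> s - 1" "s - 3 < 2 * real h" by argo+
  have h0: "h > 0" using h(2) s16 by (auto intro: Nat.gr0I)
  have hh: "2 * real h * (2 * real h) \<le> (s - 1) * (s - 1)" using h s16 by (intro mult_mono) auto
  have "2 * real m + 2 * real h + 2 * real h * (2 * real h) \<le> 2 * real r + 2"
    using hh h(1) m(2) ps r unfolding s_def[symmetric] by (simp add: algebra_simps)
  then have "real (m + h + 2 * h\<^sup>2) \<le> real (r + 1)" by (simp add: power2_eq_square)
  then have mh: "m + h + 2 * h\<^sup>2 \<le> r + 1" by linarith
  have deg: "degree (shifted_powers d S) = d * card S" by (rule degree_shifted_powers[OF d(1)])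
  have "\<bar>real_of_int (\<Sum>t\<in>{0..<int p}. Legendre (poly (shifted_powers d S) t) (int p))\<bar>
    \<le> (2 * real m - 1) * real p / (2 * real h) + real (degree (shifted_powers d S))"
    using never_square_shifted_powers[OF d S] m(1) m0 h0 mh
      monic_not_cg_0[OF lead_coeff_shifted_powers[OF d(1)]]
    by (intro Legendre_sum_bound[OF r]) (auto simp: deg)
  also have "(2 * real m - 1) * real p / (2 * real h) \<le> (2 * real m - 1) * (s + 3.7)"
  proof -
    \<comment> \<open>The product is s^2 + 0.7 s - 11.1, which exceeds s^2 because 0.7 * 16 = 11.2;
      the constant 3.7 is fitted to s > 16.\<close>
    have "real p \<le> (s + 3.7) * (s - 3)" using s16 unfolding ps by (simp add: algebra_simps)
    also have "\<dots> \<le> (s + 3.7) * (2 * real h)" using h(2) s16 by (intro mult_left_mono) auto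
    finally have "real p / (2 * real h) \<le> s + 3.7" using h0 by (simp add: divide_le_eq)
    then have "(2 * real m - 1) * (real p / (2 * real h)) \<le> (2 * real m - 1) * (s + 3.7)"
      using m0 by (intro mult_left_mono) auto
    then show ?thesis by simp
  qed
  finally show ?thesis by (simp add: poly_shifted_powers deg s_def)
qed

text \<open>If d |S| is at least sqrt p, the trivial bound p suffices. Otherwise m is half of d |S|
  rounded up, so 2 m - 1 <= d |S|, and the allowance d |S| for zeros turns 3.7 into 4.7.\<close>

lemma shifted_powers_sum_bound:
  assumes s: "sqrt (real p) > 16" and d: "d > 0" "d dvd p - 1"
    and S: "finite S" "S \<noteq> {}" "S \<subseteq> {1..<int p}"
  shows "\<bar>real_of_int (\<Sum>t\<in>{0..<int p}. Legendre (\<Prod>c\<in>S. t ^ d + c) (int p))\<bar>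
    \<le> real (d * card S) * (sqrt (real p) + 4.7)"
proof (cases "real (d * card S) < sqrt (real p)")
  case True
  define m where "m = (d * card S + 1) div 2"
  have n: "d * card S \<le> 2 * m" "2 * m \<le> d * card S + 1" by (auto simp: m_def)
  then have "2 * real m \<le> real (d * card S) + 1" by linarith
  with True have "2 * real m \<le> sqrt (real p) + 1" by linarith
  from shifted_powers_sum_bound_small[OF s d S n(1) this]
  have "\<bar>real_of_int (\<Sum>t\<in>{0..<int p}. Legendre (\<Prod>c\<in>S. t ^ d + c) (int p))\<bar>
    \<le> (2 * real m - 1) * (sqrt (real p) + 3.7) + real (d * card S)" .
  also have "(2 * real m - 1) * (sqrt (real p) + 3.7) \<le> real (d * card S) * (sqrt (real p) + 3.7)"
    using n(2) s by (intro mult_right_mono) linarith+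
  finally show ?thesis by (simp add: algebra_simps)
next
  case False
  have "\<bar>real_of_int (\<Sum>t\<in>{0..<int p}. Legendre (\<Prod>c\<in>S. t ^ d + c) (int p))\<bar>
      \<le> (\<Sum>t\<in>{0..<int p}. \<bar>real_of_int (Legendre (\<Prod>c\<in>S. t ^ d + c) (int p))\<bar>)"
    unfolding of_int_sum by (rule sum_abs)
  also have "\<dots> \<le> (\<Sum>t\<in>{0..<int p}. 1)"
    by (intro sum_mono) (simp add: Legendre_def)
  also have "\<dots> = sqrt (real p) * sqrt (real p)" by simp
  also have "\<dots> \<le> real (d * card S) * (sqrt (real p) + 4.7)"
    using False s by (intro mult_mono) auto
  finally show ?thesis .
qed

end

context prime_modulus
begin

section \<open>Sums over the exponents divisible by d, and the sieve\<close>

definition dlog_sum :: "nat \<Rightarrow> nat \<Rightarrow> int set \<Rightarrow> int" where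
  "dlog_sum g d S = (\<Sum>j | j < p - 1 \<and> d dvd j. Legendre (\<Prod>c\<in>S. int g ^ j + c) (int p))"

text \<open>Each nonzero d-th power arises from d values of t. The value t = 0 is no power of g, so
  its term is subtracted.\<close>

lemma dlog_sum_eq:
  assumes g: "residue_primroot p g" and p: "p > 2" and d: "d > 0" "d dvd p - 1"
  shows "int d * dlog_sum g d S
    = (\<Sum>t\<in>{0..<int p}. Legendre (\<Prod>c\<in>S. t ^ d + c) (int p)) - Legendre (\<Prod>S) (int p)"
proof -
  have "\<not> int g \<doteq> 0"
    using Legendre_primroot[OF g p] by (auto simp: cg_int_iff Legendre_def)
  then have "int g ^ (p - 1) \<doteq> 1" by (rule fermat_int)
  then have per: "int g ^ (j + (p - 1)) \<doteq> int g ^ j" for j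
    using cg_mult[OF cg_refl[of "int g ^ j"], of "int g ^ (p - 1)" 1] by (simp add: power_add)
  have "int d * dlog_sum g d S = (\<Sum>j<p - 1. Legendre (\<Prod>c\<in>S. int g ^ (d * j) + c) (int p))"
    unfolding dlog_sum_def using p d(2)
    by (intro sum_periodic_multiples Legendre_cg cg_prod cg_add per cg_refl) auto
  also have "\<dots> = (\<Sum>j<p - 1. Legendre (\<Prod>c\<in>S. (int g ^ j mod int p) ^ d + c) (int p))"
  proof (intro sum.cong refl Legendre_cg cg_prod cg_add)
    fix j
    have "int g ^ j \<doteq> int g ^ j mod int p" by (simp add: cg_int_iff)
    then have "(int g ^ j) ^ d \<doteq> (int g ^ j mod int p) ^ d" by (rule cg_power)
    then show "int g ^ (d * j) \<doteq> (int g ^ j mod int p) ^ d" by (simp add: power_mult[symmetric] mult.commute)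
  qed simp
  also have "\<dots> = (\<Sum>t\<in>{1..<int p}. Legendre (\<Prod>c\<in>S. t ^ d + c) (int p))"
    by (rule sum.reindex_bij_betw[OF primroot_power_bij[OF g]])
  also have "\<dots> = (\<Sum>t\<in>insert 0 {1..<int p}. Legendre (\<Prod>c\<in>S. t ^ d + c) (int p)) - Legendre (\<Prod>S) (int p)"
    using d(1) by (simp add: power_0_left)
  also have "insert 0 {1..<int p} = {0..<int p}" using p by auto
  finally show ?thesis .
qed

text \<open>The degree d |S| of the polynomial in t is offset by the factor d in
  \<open>dlog_sum_eq\<close>, so the main term is independent of d.\<close>

lemma dlog_sum_bound:
  assumes g: "residue_primroot p g" and s: "sqrt (real p) > 16" and d: "d > 0" "d dvd p - 1"
    and S: "finite S" "S \<noteq> {}" "S \<subseteq> {1..<int p}"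
  shows "\<bar>real_of_int (dlog_sum g d S)\<bar> \<le> real (card S) * (sqrt (real p) + 4.7) + 1 / real d"
proof -
  have p: "p > 2" using s real_sqrt_le_mono[of "real p" 256] by (cases "p \<le> 2") auto
  let ?X = "\<Sum>t\<in>{0..<int p}. Legendre (\<Prod>c\<in>S. t ^ d + c) (int p)"
  have "real d * \<bar>real_of_int (dlog_sum g d S)\<bar> = \<bar>real_of_int (int d * dlog_sum g d S)\<bar>"
    by (simp add: abs_mult)
  also have "\<dots> \<le> \<bar>real_of_int ?X\<bar> + 1"
    unfolding dlog_sum_eq[OF g p d] using Legendre_values[of "\<Prod>S" "int p"] by auto
  also have "\<dots> \<le> real (d * card S) * (sqrt (real p) + 4.7) + 1"
    using shifted_powers_sum_bound[OF s d S] by simp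
  finally show ?thesis using d(1) by (simp add: field_simps)
qed

lemma dlog_sum_singleton:
  assumes g: "residue_primroot p g" and p: "p > 2"
  shows "\<bar>dlog_sum g 1 {c}\<bar> \<le> 1"
  using dlog_sum_eq[OF g p, of 1 "{c}"] sum_Legendre_shift[OF p, of c] Legendre_values[of c "int p"]
  by auto

text \<open>Here the degree is 2 and m = 1, so 2 m - 1 = 1 and the main term is half that of
  \<open>dlog_sum_bound\<close>. The constant is 3.7, plus 2 for zeros and 1 for t = 0.\<close>

lemma dlog_sum_pair:
  assumes g: "residue_primroot p g" and s: "sqrt (real p) > 16"
    and S: "card S = 2" "S \<subseteq> {1..<int p}"
  shows "\<bar>real_of_int (dlog_sum g 1 S)\<bar> \<le> sqrt (real p) + 6.7"
proof -
  have p: "p > 2" using s real_sqrt_le_mono[of "real p" 256] by (cases "p \<le> 2") auto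
  have "finite S" "S \<noteq> {}" using S(1) by (auto intro: card_ge_0_finite)
  then have "\<bar>real_of_int (\<Sum>t\<in>{0..<int p}. Legendre (\<Prod>c\<in>S. t ^ 1 + c) (int p))\<bar>
    \<le> (2 * real 1 - 1) * (sqrt (real p) + 3.7) + real (1 * card S)"
    using S s by (intro shifted_powers_sum_bound_small) auto
  then show ?thesis
    using dlog_sum_eq[OF g p, of 1 S] Legendre_values[of "\<Prod>S" "int p"] S(1) by auto
qed

lemma Legendre_sum_over_coprime:
  assumes "p > 2"
  shows "(\<Sum>j | j < p - 1 \<and> coprime j (p - 1). Legendre (\<Prod>c\<in>S. int g ^ j + c) (int p))
    = (\<Sum>Q\<in>Pow (prime_factors (p - 1)). (-1) ^ card Q * dlog_sum g (\<Prod>Q) S)" (is "?lhs = _")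
proof -
  let ?F = "\<lambda>j. Legendre (\<Prod>c\<in>S. int g ^ j + c) (int p)" and ?P = "Pow (prime_factors (p - 1))"
  have fil: "(\<Sum>j | j < p - 1 \<and> R j. ?F j) = (\<Sum>j<p - 1. (if R j then 1 else 0) * ?F j)" for R
    by (rule sum.mono_neutral_cong_left) auto
  have "?lhs = (\<Sum>j<p - 1. (\<Sum>Q\<in>?P. (-1) ^ card Q * (if \<Prod>Q dvd j then 1 else 0)) * ?F j)"
    unfolding fil using assms by (simp only: coprime_indicator zero_less_diff)
  also have "\<dots> = (\<Sum>Q\<in>?P. (-1) ^ card Q * (\<Sum>j<p - 1. (if \<Prod>Q dvd j then 1 else 0) * ?F j))"
    unfolding sum_distrib_right sum_distrib_left by (subst sum.swap) (simp only: mult.assoc)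
  finally show ?thesis unfolding dlog_sum_def fil .
qed

lemma exists_primitive_avoiding_nonresidues:
  assumes g: "residue_primroot p g" and C: "C \<subseteq> {1..<int p}" "card C = k" and k: "k \<ge> 2"
    and s: "sqrt (real p) > 16"
    and w: "w = card (Pow (prime_factors (p - 1)))" "w \<ge> 2"
    and small: "2 * (real w * (real k * 2 ^ (k - 1))) < sqrt (real p)"
    and hyp: "real w * (real k * 2 ^ (k - 1)) * sqrt (real p) < real (totient (p - 1))"
  shows "\<exists>j. coprime j (p - 1) \<and> (\<forall>c\<in>C. Legendre (int g ^ j + c) (int p) \<noteq> -1)"
proof (rule ccontr)
  assume neg: "\<not> ?thesis"
  define s where "s = sqrt (real p)"
  define Y where "Y S = (\<Sum>j | j < p - 1 \<and> coprime j (p - 1). Legendre (\<Prod>c\<in>S. int g ^ j + c) (int p))" for S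
  have p: "p > 2" using assms(5) real_sqrt_le_mono[of "real p" 256] by (cases "p \<le> 2") auto
  have fin: "finite C" using C(2) k by (auto intro: card_ge_0_finite)
  have "(\<Sum>S\<in>Pow C. Y S) = (\<Sum>j | j < p - 1 \<and> coprime j (p - 1). \<Prod>c\<in>C. Legendre (int g ^ j + c) (int p) + 1)"
    unfolding Y_def by (subst sum.swap) (simp add: prod_add[OF fin] Legendre_prod[OF p])
  also have "\<dots> = 0"
  proof (intro sum.neutral ballI)
    fix j assume "j \<in> {j. j < p - 1 \<and> coprime j (p - 1)}"
    with neg obtain c where "c \<in> C" "Legendre (int g ^ j + c) (int p) = -1" by blast
    then show "(\<Prod>c\<in>C. Legendre (int g ^ j + c) (int p) + 1) = 0"
      using fin by (intro prod_zero) (auto intro!: bexI[of _ c])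
  qed
  finally have Y0: "(\<Sum>S\<in>Pow C. Y S) = 0" .
  have Y_empty: "Y {} = int (totient (p - 1))"
  proof -
    have L1: "Legendre 1 (int p) = 1" using Legendre_prod[OF p, of id "{}"] by simp
    have "totatives (p - 1) = {j. j < p - 1 \<and> coprime j (p - 1)}"
      using totatives_eq_lessThan[of "p - 1"] p by auto
    then show ?thesis unfolding Y_def totient_def by (simp add: L1)
  qed
  have "(\<Sum>S\<in>Pow C. Y S) = Y {} + (\<Sum>S\<in>Pow C - {{}}. Y S)"
    using fin by (intro sum.remove) auto
  then have "int (totient (p - 1)) = - (\<Sum>S\<in>Pow C - {{}}. Y S)"
    unfolding Y0 Y_empty by linarith
  then have "real_of_int (int (totient (p - 1))) = real_of_int (- (\<Sum>S\<in>Pow C - {{}}. Y S))"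
    by (rule arg_cong)
  then have "real (totient (p - 1)) = - (\<Sum>S\<in>Pow C - {{}}. real_of_int (Y S))"
    by (simp only: of_int_minus of_int_sum of_int_of_nat_eq)
  also have "\<dots> \<le> (\<Sum>S\<in>Pow C - {{}}. \<bar>real_of_int (Y S)\<bar>)"
    using sum_abs[of "\<lambda>S. real_of_int (Y S)" "Pow C - {{}}"] by linarith
  finally have totient_le: "real (totient (p - 1)) \<le> (\<Sum>S\<in>Pow C - {{}}. \<bar>real_of_int (Y S)\<bar>)" .

  obtain S0 where S0: "S0 \<subseteq> C" "card S0 = 2" using obtain_subset_with_card_n[of 2 C] C(2) k by auto
  \<comment> \<open>\<open>a S\<close> is the general bound for one d without its 1/d.
    \<open>b S\<close> is the saving at d = 1: all but 1 for a singleton, and for the single pair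
    \<open>S0\<close> the general 2 s + 10.4 less s + 6.7.\<close>
  define a where "a S = real (card S) * (s + 4.7)" for S :: "int set"
  define b where "b S = (if card S = 1 then s + 4.7 else 0) + (if S = S0 then s + 3.7 else 0)" for S :: "int set"
  have Y_le: "\<bar>real_of_int (Y S)\<bar> \<le> a S + 1 - b S + (real w - 1) * (a S + 1 / 2)" if S: "S \<in> Pow C - {{}}" for S
  proof -
    have S': "finite S" "S \<noteq> {}" "S \<subseteq> {1..<int p}" using S fin C(1) finite_subset by auto
    let ?P = "Pow (prime_factors (p - 1))"
    have "\<bar>real_of_int (Y S)\<bar> \<le> (\<Sum>Q\<in>?P. \<bar>real_of_int ((-1) ^ card Q * dlog_sum g (\<Prod>Q) S)\<bar>)"
      unfolding Y_def Legendre_sum_over_coprime[OF p] of_int_sum by (rule sum_abs)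
    also have "\<dots> = (\<Sum>Q\<in>?P. \<bar>real_of_int (dlog_sum g (\<Prod>Q) S)\<bar>)"
      by (simp add: abs_mult power_abs)
    also have "\<dots> = \<bar>real_of_int (dlog_sum g 1 S)\<bar> + (\<Sum>Q\<in>?P - {{}}. \<bar>real_of_int (dlog_sum g (\<Prod>Q) S)\<bar>)"
      by (subst sum.remove[of _ "{}"]) auto
    also have "(\<Sum>Q\<in>?P - {{}}. \<bar>real_of_int (dlog_sum g (\<Prod>Q) S)\<bar>) \<le> (\<Sum>Q\<in>?P - {{}}. a S + 1 / 2)"
    proof (rule sum_mono)
      fix Q assume Q: "Q \<in> ?P - {{}}"
      then have pr: "finite Q" "\<forall>q\<in>Q. prime q" using finite_subset[of Q "prime_factors (p - 1)"] by auto
      have dvd: "\<Prod>Q dvd p - 1" unfolding prod_primes_dvd_iff[OF pr] using Q by (auto simp: in_prime_factors_iff)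
      then have pos: "\<Prod>Q > 0" using p by (auto intro!: Nat.gr0I)
      obtain q where q: "q \<in> Q" using Q by blast
      then have "q dvd \<Prod>Q" using pr(1) by (rule dvd_prodI[rotated])
      then have "q \<le> \<Prod>Q" using pos by (rule dvd_imp_le)
      moreover have "q \<ge> 2" using q pr(2) prime_ge_2_nat by blast
      ultimately have "2 \<le> \<Prod>Q" by linarith
      then have "2 \<le> real (\<Prod>Q)" by (metis of_nat_le_iff of_nat_numeral)
      moreover have "1 / x \<le> 1 / 2" if "2 \<le> x" for x :: real using that by (simp add: field_simps)
      ultimately have "1 / real (\<Prod>Q) \<le> 1 / 2" by blast
      then show "\<bar>real_of_int (dlog_sum g (\<Prod>Q) S)\<bar> \<le> a S + 1 / 2"
        using dlog_sum_bound[OF g assms(5) pos dvd S'] unfolding a_def s_def by linarith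
    qed
    also have "\<dots> = (real w - 1) * (a S + 1 / 2)"
      using w by (simp add: card_Diff_subset of_nat_diff)
    finally have *: "\<bar>real_of_int (Y S)\<bar> \<le> \<bar>real_of_int (dlog_sum g 1 S)\<bar> + (real w - 1) * (a S + 1 / 2)" by simp
    have "\<bar>real_of_int (dlog_sum g 1 S)\<bar> \<le> a S + 1 - b S"
    proof (cases "card S = 1")
      case True
      then obtain c where "S = {c}" by (metis card_1_singletonE)
      then show ?thesis using dlog_sum_singleton[OF g p, of c] True S0(2) by (auto simp: a_def b_def)
    next
      case False
      show ?thesis
      proof (cases "S = S0")
        case True
        then show ?thesis using dlog_sum_pair[OF g assms(5) S0(2)] S'(3) S0(2) by (simp add: a_def b_def s_def)
      next
        case False
        then show ?thesis using dlog_sum_bound[OF g assms(5), of 1 S] S' \<open>card S \<noteq> 1\<close> by (simp add: a_def b_def s_def)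
      qed
    qed
    with * show ?thesis by linarith
  qed
  define K where "K = real k * 2 ^ (k - 1)"
  have sum_a: "(\<Sum>S\<in>Pow C - {{}}. a S) = K * (s + 4.7)"
  proof -
    have "(\<Sum>S\<in>Pow C - {{}}. real (card S)) = real (\<Sum>S\<in>Pow C. card S)"
      unfolding of_nat_sum using fin by (intro sum.mono_neutral_left) auto
    also have "\<dots> = K" using sum_card_Pow[OF fin] C(2) by (simp add: K_def)
    finally show ?thesis unfolding a_def sum_distrib_right[symmetric] by simp
  qed
  have sum_b: "(\<Sum>S\<in>Pow C - {{}}. b S) = real k * (s + 4.7) + (s + 3.7)"
  proof -
    have "(\<Sum>S\<in>Pow C - {{}}. if card S = 1 then s + 4.7 else 0) = (\<Sum>S | S \<subseteq> C \<and> card S = 1. s + 4.7)"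
      using fin by (intro sum.mono_neutral_cong_right) auto
    also have "\<dots> = real k * (s + 4.7)" using n_subsets[OF fin, of 1] C(2) by simp
    finally have 1: "(\<Sum>S\<in>Pow C - {{}}. if card S = 1 then s + 4.7 else 0) = real k * (s + 4.7)" .
    have "(\<Sum>S\<in>Pow C - {{}}. if S = S0 then s + 3.7 else 0) = s + 3.7"
      using fin S0 by (subst sum.delta) auto
    with 1 show ?thesis unfolding b_def sum.distrib by simp
  qed
  have sum_1: "(\<Sum>S\<in>Pow C - {{}}. 1::real) \<le> 2 ^ k"
    using fin C(2) by (simp add: card_Diff_subset card_Pow of_nat_diff)
  have "(\<Sum>S\<in>Pow C - {{}}. \<bar>real_of_int (Y S)\<bar>)
      \<le> (\<Sum>S\<in>Pow C - {{}}. real w * a S + (real w + 1) / 2 * 1 - b S)"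
  proof (rule sum_mono)
    fix S assume "S \<in> Pow C - {{}}"
    from Y_le[OF this] show "\<bar>real_of_int (Y S)\<bar> \<le> real w * a S + (real w + 1) / 2 * 1 - b S"
      by (simp add: field_simps)
  qed
  also have "\<dots> = real w * (K * (s + 4.7)) + (real w + 1) / 2 * (\<Sum>S\<in>Pow C - {{}}. 1)
      - (real k * (s + 4.7) + (s + 3.7))"
    unfolding sum_subtractf sum.distrib sum_distrib_left[symmetric] sum_a sum_b ..
  also have "\<dots> \<le> real w * (K * (s + 4.7)) + (real w + 1) / 2 * K - (real k * (s + 4.7) + (s + 3.7))"
  proof -
    have "(2::real) ^ k = 2 * 2 ^ (k - 1)" using k by (cases k) auto
    also have "\<dots> \<le> K" unfolding K_def using k by (intro mult_right_mono) auto
    finally have "(\<Sum>S\<in>Pow C - {{}}. 1::real) \<le> K" using sum_1 by linarith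
    then show ?thesis by (intro diff_right_mono add_left_mono mult_left_mono) auto
  qed
  \<comment> \<open>The excess over w K s is 5.2 w K + K / 2, below 2.6 s + s / 8 since 2 w K < s
    and w >= 2. The saving exceeds 3 s since k >= 2.\<close>
  also have "\<dots> < real w * K * s"
  proof -
    have K0: "K \<ge> 0" by (simp add: K_def)
    then have "2 * K \<le> real w * K" using w(2) by (intro mult_right_mono) auto
    moreover have "2 * (s + 4.7) \<le> real k * (s + 4.7)"
      using k assms(5) by (intro mult_right_mono) (auto simp: s_def)
    moreover have "2 * (real w * K) < s" using small by (simp add: K_def s_def)
    moreover have "s > 16" using assms(5) by (simp add: s_def)
    moreover have "real w * (K * (s + 4.7)) + (real w + 1) / 2 * K
        = real w * K * s + 5.2 * (real w * K) + K / 2" by (simp add: field_simps)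
    moreover have "X - (Z + (s + 3.7)) < R" if "2 * K \<le> T" "2 * (s + 4.7) \<le> Z" "2 * T < s" "s > 16"
      "X = R + 5.2 * T + K / 2" for X Z R T :: real
      using that by simp
    ultimately show ?thesis by blast
  qed
  finally show False using hyp totient_le by (simp add: K_def s_def)
qed

end

section \<open>From a sumset decomposition to shifts of a primitive element\<close>

theorem theorem1p1:
  fixes p k :: nat
  assumes "prime p" and "p > 3" and "k \<ge> 2"
    and "real (totient (p - 1)) / (real (W (p - 1)) * sqrt (real p)) > real k * 2 ^ (k - 1)"
  shows "\<forall>A B. A \<subseteq> {0..<p} \<longrightarrow> B \<subseteq> {0..<p} \<longrightarrow> card A \<ge> 2 \<longrightarrow> card B = k
           \<longrightarrow> sumset_mod p A B \<noteq> prim_elems p"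
proof (intro allI impI notI)
  fix A B assume A: "A \<subseteq> {0..<p}" and B: "B \<subseteq> {0..<p}" "card B = k" and AB: "sumset_mod p A B = prim_elems p"
  interpret prime_modulus p by standard (rule assms(1))
  define s where "s = sqrt (real p)"
  define w where "w = card (Pow (prime_factors (p - 1)))"
  define K where "K = real k * 2 ^ (k - 1)"
  have s0: "s > 0" "real p = s * s" using assms(2) by (simp_all add: s_def)
  have "odd p" using assms(1,2) by (simp add: prime_odd_nat)
  then have ev: "even (p - 1)" "p - 1 > 0" using assms(2) by auto
  have w2: "w \<ge> 2"
  proof -
    have "2 \<in> prime_factors (p - 1)" using ev by (auto simp: in_prime_factors_iff)
    then have "{{}, {2}} \<subseteq> Pow (prime_factors (p - 1))" by auto
    then have "card {{}, {2::nat}} \<le> w" unfolding w_def by (intro card_mono) auto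
    then show ?thesis by simp
  qed
  have wW: "w \<le> W (p - 1)" unfolding w_def by (rule card_Pow_prime_factors_le_W[OF ev(2)])
  have K4: "K \<ge> 4"
  proof -
    have "(2::real) ^ 1 \<le> 2 ^ (k - 1)" using assms(3) by (intro power_increasing) auto
    then have "2 * 2 \<le> real k * 2 ^ (k - 1)" using assms(3) by (intro mult_mono) auto
    then show ?thesis by (simp add: K_def)
  qed
  have "K * (real (W (p - 1)) * s) < real (totient (p - 1))"
    using assms(4) w2 wW s0(1) by (simp add: K_def s_def less_divide_eq)
  moreover have "K * (real w * s) \<le> K * (real (W (p - 1)) * s)"
    using wW s0(1) K4 by (intro mult_left_mono mult_right_mono) auto
  ultimately have hyp: "real w * K * s < real (totient (p - 1))" by (simp add: mult_ac)
  \<comment> \<open>The bound (p - 1) / 2 for the totient turns the hypothesis into 2 w K < s. With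
    w >= 2 and K >= 4 this yields s > 16, so small primes need no separate treatment.\<close>
  have "real (2 * totient (p - 1)) \<le> real (p - 1)" by (rule of_nat_mono[OF totient_even_le[OF ev]])
  then have "2 * (real w * K * s) < s * s" using hyp s0(2) by linarith
  then have small: "2 * (real w * K) < s" using s0(1) by (simp add: mult.assoc[symmetric])
  have "2 * 4 \<le> real w * K" using w2 K4 by (intro mult_mono) auto
  then have s16: "s > 16" using small by linarith
  have "real k \<le> real k * 2 ^ (k - 1)" using mult_left_mono[of 1 "2 ^ (k - 1)" "real k"] by simp
  moreover have "K \<le> real w * K" using mult_right_mono[of 1 "real w" K] w2 K4 by simp
  ultimately have "real k < s" using small K4 unfolding K_def by linarith
  moreover have "2 * s \<le> s * s" using s16 by (intro mult_right_mono) auto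
  ultimately have kp: "k \<le> p - 1" using s0(2) s16 by linarith
  obtain g where g: "residue_primroot p g"
    using prime_primitive_root_exists[of p] assms(1,2) by auto

  obtain b0 where b0: "b0 \<in> B" using B(2) assms(3) by fastforce
  have finB: "finite B" using B(1) finite_subset by blast
  have cardB: "card (B - {b0}) = k - 1" using b0 B(2) finB by simp
  then obtain b1 where b1: "b1 \<in> B" "b1 \<noteq> b0" using assms(3) by (metis DiffD1 DiffD2 One_nat_def Suc_1 Suc_le_eq all_not_in_conv card.empty diff_is_0_eq insertCI not_le)
  define c where "c b b' = (int b' - int b) mod int p" for b b' :: nat
  \<comment> \<open>One shift leads from b0 to b1 and one from each other b to b0, at most 1 + (k -
    1) in all. The set is padded below to exactly k nonzero residues.\<close>
  define C0 where "C0 = insert (c b0 b1) ((\<lambda>b. c b b0) ` (B - {b0}))"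
  have c_range: "c b b' \<in> {1..<int p}" if "b \<in> B" "b' \<in> B" "b \<noteq> b'" for b b'
  proof -
    have "b < p" "b' < p" using that B(1) by auto
    then have "\<bar>int b' - int b\<bar> < int p" by linarith
    then have "\<not> int p dvd int b' - int b"
      using that(3) zdvd_imp_le[of "int p" "\<bar>int b' - int b\<bar>"] by auto
    then have "c b b' \<noteq> 0" by (auto simp: c_def dvd_eq_mod_eq_0)
    moreover have "0 \<le> c b b'" "c b b' < int p" using assms(2) by (simp_all add: c_def)
    ultimately show ?thesis by auto
  qed
  have C0: "C0 \<subseteq> {1..<int p}"
    unfolding C0_def using b0 b1 by (intro insert_subsetI image_subsetI c_range) auto
  have "card C0 \<le> Suc (card ((\<lambda>b. c b b0) ` (B - {b0})))" unfolding C0_def by (rule card_insert_le_m1) auto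
  also have "\<dots> \<le> Suc (card (B - {b0}))" using finB by (simp add: card_image_le)
  also have "\<dots> = k" using cardB assms(3) by simp
  finally have "card C0 \<le> k" .
  moreover have "k \<le> card {1..<int p}" using kp by simp
  ultimately obtain C where C: "C0 \<subseteq> C" "C \<subseteq> {1..<int p}" "card C = k"
    using exists_subset_between[of C0 k "{1..<int p}"] C0 by auto
  obtain j where j: "coprime j (p - 1)" "\<forall>c\<in>C. Legendre (int g ^ j + c) (int p) \<noteq> -1"
    using exists_primitive_avoiding_nonresidues[OF g C(2,3) assms(3) _ w_def w2] s16 small hyp
    unfolding s_def K_def by blast
  have "g ^ j mod p \<in> sumset_mod p A B" unfolding AB by (rule primroot_power[OF g j(1)])
  then obtain a b where ab: "a \<in> A" "b \<in> B" "g ^ j mod p = (a + b) mod p" by (auto simp: sumset_mod_def)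
  \<comment> \<open>a + b' is in the sumset, hence primitive and a nonresidue; yet modulo p it is
    g^j plus a shift in C, which \<open>j\<close> was chosen to exclude.\<close>
  define b' where "b' = (if b = b0 then b1 else b0)"
  have b': "b' \<in> B" "c b b' \<in> C" using b0 b1 ab(2) C(1) by (auto simp: b'_def C0_def)
  have "(a + b') mod p \<in> prim_elems p" unfolding AB[symmetric] sumset_mod_def using ab(1) b'(1) by blast
  then have "Legendre (int ((a + b') mod p)) (int p) = -1"
    using assms(2) by (intro Legendre_primroot) (auto simp: prim_elems_def)
  moreover have "Legendre (int ((a + b') mod p)) (int p) = Legendre (int g ^ j + c b b') (int p)"
  proof (rule Legendre_cg)
    have "[int (g ^ j) = int (a + b)] (mod int p)" using ab(3) by (metis cong_def cong_int_iff)
    moreover have "[c b b' = int b' - int b] (mod int p)" by (simp add: c_def)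
    ultimately have "[int (g ^ j) + c b b' = int (a + b) + (int b' - int b)] (mod int p)" by (rule cong_add)
    then have "[int g ^ j + c b b' = int (a + b')] (mod int p)" by simp
    then show "int ((a + b') mod p) \<doteq> int g ^ j + c b b'"
      unfolding cg_int_iff by (metis cong_mod_left cong_sym zmod_int)
  qed
  ultimately show False using j(2) b'(2) by simp
qed

end
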